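(* Let $\mathcal{X},\mathcal{Y},\mathcal{Z}$ be length abelian categories and let $R(\mathcal{Y},\mathcal{X},\mathcal{Z})$ be a recollement of $\mathcal{X}$ relative to $\mathcal{Y}$ and $\mathcal{Z}$, with functors $i^{*},i^{!}:\mathcal{X}\to\mathcal{Y}$, $i_{*}:\mathcal{Y}\to\mathcal{X}$, $j^{*}:\mathcal{X}\to\mathcal{Z}$, $j_{!},j_{*}:\mathcal{Z}\to\mathcal{X}$. Let $\mathcal{E}_{\mathcal{Y}}$ and $\mathcal{E}_{\mathcal{Z}}$ be subcategories of $\mathcal{Y}$ and $\mathcal{Z}$ respectively, and let $$\mathcal{E}_{\mathcal{X}}=\{X\in\mathcal{X}\mid j^{*}X\in\mathcal{E}_{\mathcal{Z}},\ i^{!}X\in\mathcal{E}_{\mathcal{Y}}\}.$$ If $i^{!}$ is exact, then the following are equivalent: (1) $\mathcal{E}_{\mathcal{Y}}$ and $\mathcal{E}_{\mathcal{Z}}$ are left Schur (in $\mathcal{Y}$ and $\mathcal{Z}$ respectively). (2) $\mathcal{E}_{\mathcal{X}}$ is left Schur (in $\mathcal{X}$).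
   Context: A length abelian category is an abelian category in which every object has finite length. "Subcategory" means a full subcategory closed under isomorphisms and containing the zero object. Recollement: for abelian categories $\mathcal{X},\mathcal{Y},\mathcal{Z}$, a recollement of $\mathcal{X}$ relative to $\mathcal{Y}$ and $\mathcal{Z}$ consists of functors $i^{*},i^{!}:\mathcal{X}\to\mathcal{Y}$, $i_{*}:\mathcal{Y}\to\mathcal{X}$, $j^{*}:\mathcal{X}\to\mathcal{Z}$, $j_{!},j_{*}:\mathcal{Z}\to\mathcal{X}$ such that: (a) $(i^{*},i_{*})$, $(i_{*},i^{!})$, $(j_{!},j^{*})$, $(j^{*},j_{*})$ are adjoint pairs (left adjoint written first); (b) $i_{*},j_{!},j_{*}$ are fully faithful; (c) $\operatorname{Im} i_{*}=\operatorname{Ker} j^{*}$ (the essential image of $i_*$ is the full subcategory of objects $X$ with $j^{*}X=0$). Let $\mathcal{A}$ be a length abelian category and $\mathcal{E}$ a subcategory. $\mathcal{E}$ is extension-closed in $\mathcal{A}$ if for every short exact sequence $0\to X\to Y\to Z\to 0$ in $\mathcal{A}$ with $X,Z\in\mathcal{E}$ one has $Y\in\mathcal{E}$. If $\mathcal{E}$ is extension-closed, a non-zero object $M\in\mathcal{E}$ is a simple object in $\mathcal{E}$ if there is no short exact sequence $0\to L\to M\to N\to 0$ in $\mathcal{A}$ with $L,M,N\in\mathcal{E}$ and $L,N\neq 0$. A non-zero object $M\in\mathcal{A}$ is left Schurian for a collection $\mathcal{C}$ of objects of $\mathcal{A}$ if every morphism $M\to C$ with $C\in\mathcal{C}$ is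 either zero or an injection (monomorphism) in $\mathcal{A}$. $\mathcal{E}$ is left Schur if it is extension-closed in $\mathcal{A}$ and every simple object in $\mathcal{E}$ is left Schurian for $\mathcal{E}$. *)

theory Defs
  imports "HOL-Algebra.Group"
begin

section \<open>Categories enriched with an addition on parallel morphisms\<close>

text \<open>
  One record carries a category together with its preadditive structure: \<open>hadd\<close> is only meaningful
  on parallel morphisms, and \<open>hzero C A B\<close> is the zero morphism from \<open>A\<close> to \<open>B\<close>.
  Composition is written in the usual order (first \<open>f\<close>, then \<open>g\<close> in \<open>g \<cdot> f\<close>).
\<close>

record ('o, 'm) precat =
  Obj :: "'o set"
  Arr :: "'m set"
  Dom :: "'m \<Rightarrow> 'o"
  Cod :: "'m \<Rightarrow> 'o"
  Id :: "'o \<Rightarrow> 'm"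
  Comp :: "'m \<Rightarrow> 'm \<Rightarrow> 'm"  (infixl \<open>\<cdot>\<index>\<close> 70)
  hadd :: "'m \<Rightarrow> 'm \<Rightarrow> 'm"
  hzero :: "'o \<Rightarrow> 'o \<Rightarrow> 'm"

definition Hom :: "('o, 'm) precat \<Rightarrow> 'o \<Rightarrow> 'o \<Rightarrow> 'm set" where
  "Hom C A B = {f \<in> Arr C. Dom C f = A \<and> Cod C f = B}"

locale category =
  fixes C :: "('o, 'm) precat" (structure)
  assumes Dom_in: "f \<in> Arr C \<Longrightarrow> Dom C f \<in> Obj C"
    and Cod_in: "f \<in> Arr C \<Longrightarrow> Cod C f \<in> Obj C"
    and Id_in: "A \<in> Obj C \<Longrightarrow> Id C A \<in> Hom C A A"
    and Comp_in: "\<lbrakk>f \<in> Hom C A B; g \<in> Hom C B D\<rbrakk> \<Longrightarrow> g \<cdot> f \<in> Hom C A D"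
    and Comp_Id: "f \<in> Hom C A B \<Longrightarrow> f \<cdot> Id C A = f"
    and Id_Comp: "f \<in> Hom C A B \<Longrightarrow> Id C B \<cdot> f = f"
    and Comp_assoc: "\<lbrakk>f \<in> Hom C A B; g \<in> Hom C B D; h \<in> Hom C D E\<rbrakk>
      \<Longrightarrow> h \<cdot> (g \<cdot> f) = (h \<cdot> g) \<cdot> f"

definition monic :: "('o, 'm) precat \<Rightarrow> 'm \<Rightarrow> bool" where
  "monic C f \<longleftrightarrow> f \<in> Arr C \<and>
     (\<forall>A. \<forall>g \<in> Hom C A (Dom C f). \<forall>h \<in> Hom C A (Dom C f).
        f \<cdot>\<^bsub>C\<^esub> g = f \<cdot>\<^bsub>C\<^esub> h \<longrightarrow> g = h)"

definition epic :: "('o, 'm) precat \<Rightarrow> 'm \<Rightarrow> bool" where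
  "epic C f \<longleftrightarrow> f \<in> Arr C \<and>
     (\<forall>B. \<forall>g \<in> Hom C (Cod C f) B. \<forall>h \<in> Hom C (Cod C f) B.
        g \<cdot>\<^bsub>C\<^esub> f = h \<cdot>\<^bsub>C\<^esub> f \<longrightarrow> g = h)"

definition is_iso :: "('o, 'm) precat \<Rightarrow> 'm \<Rightarrow> bool" where
  "is_iso C f \<longleftrightarrow> f \<in> Arr C \<and>
     (\<exists>g \<in> Hom C (Cod C f) (Dom C f).
        g \<cdot>\<^bsub>C\<^esub> f = Id C (Dom C f) \<and> f \<cdot>\<^bsub>C\<^esub> g = Id C (Cod C f))"

definition isomorphic :: "('o, 'm) precat \<Rightarrow> 'o \<Rightarrow> 'o \<Rightarrow> bool" where
  "isomorphic C A B \<longleftrightarrow> (\<exists>f \<in> Hom C A B. is_iso C f)"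

definition zero_object :: "('o, 'm) precat \<Rightarrow> 'o \<Rightarrow> bool" where
  "zero_object C Z \<longleftrightarrow> Z \<in> Obj C \<and>
     (\<forall>A \<in> Obj C. (\<exists>!f. f \<in> Hom C A Z) \<and> (\<exists>!f. f \<in> Hom C Z A))"

definition is_kernel :: "('o, 'm) precat \<Rightarrow> 'm \<Rightarrow> 'm \<Rightarrow> bool" where
  "is_kernel C k f \<longleftrightarrow> k \<in> Arr C \<and> f \<in> Arr C \<and> Cod C k = Dom C f \<and>
     f \<cdot>\<^bsub>C\<^esub> k = hzero C (Dom C k) (Cod C f) \<and>
     (\<forall>A. \<forall>h \<in> Hom C A (Dom C f). f \<cdot>\<^bsub>C\<^esub> h = hzero C A (Cod C f) \<longrightarrow>
        (\<exists>!u. u \<in> Hom C A (Dom C k) \<and> k \<cdot>\<^bsub>C\<^esub> u = h))"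

definition is_cokernel :: "('o, 'm) precat \<Rightarrow> 'm \<Rightarrow> 'm \<Rightarrow> bool" where
  "is_cokernel C q f \<longleftrightarrow> q \<in> Arr C \<and> f \<in> Arr C \<and> Dom C q = Cod C f \<and>
     q \<cdot>\<^bsub>C\<^esub> f = hzero C (Dom C f) (Cod C q) \<and>
     (\<forall>B. \<forall>h \<in> Hom C (Cod C f) B. h \<cdot>\<^bsub>C\<^esub> f = hzero C (Dom C f) B \<longrightarrow>
        (\<exists>!u. u \<in> Hom C (Cod C q) B \<and> u \<cdot>\<^bsub>C\<^esub> q = h))"

locale preadditive_category = category +
  assumes Hom_comm_group: "\<lbrakk>A \<in> Obj C; B \<in> Obj C\<rbrakk>
      \<Longrightarrow> comm_group \<lparr>carrier = Hom C A B, mult = hadd C, one = hzero C A B\<rparr>"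
    and Comp_hadd_right: "\<lbrakk>f \<in> Hom C A B; f' \<in> Hom C A B; g \<in> Hom C B D\<rbrakk>
      \<Longrightarrow> g \<cdot> hadd C f f' = hadd C (g \<cdot> f) (g \<cdot> f')"
    and Comp_hadd_left: "\<lbrakk>f \<in> Hom C A B; g \<in> Hom C B D; g' \<in> Hom C B D\<rbrakk>
      \<Longrightarrow> hadd C g g' \<cdot> f = hadd C (g \<cdot> f) (g' \<cdot> f)"

definition is_biproduct ::
    "('o, 'm) precat \<Rightarrow> 'o \<Rightarrow> 'o \<Rightarrow> 'o \<Rightarrow> 'm \<Rightarrow> 'm \<Rightarrow> 'm \<Rightarrow> 'm \<Rightarrow> bool" where
  "is_biproduct C A B P i1 i2 p1 p2 \<longleftrightarrow>
     i1 \<in> Hom C A P \<and> i2 \<in> Hom C B P \<and> p1 \<in> Hom C P A \<and> p2 \<in> Hom C P B \<and>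
     p1 \<cdot>\<^bsub>C\<^esub> i1 = Id C A \<and> p2 \<cdot>\<^bsub>C\<^esub> i2 = Id C B \<and>
     p2 \<cdot>\<^bsub>C\<^esub> i1 = hzero C A B \<and> p1 \<cdot>\<^bsub>C\<^esub> i2 = hzero C B A \<and>
     hadd C (i1 \<cdot>\<^bsub>C\<^esub> p1) (i2 \<cdot>\<^bsub>C\<^esub> p2) = Id C P"

locale additive_category = preadditive_category +
  assumes ex_zero_object: "\<exists>Z. zero_object C Z"
    and ex_biproduct: "\<lbrakk>A \<in> Obj C; B \<in> Obj C\<rbrakk>
      \<Longrightarrow> \<exists>P \<in> Obj C. \<exists>i1 i2 p1 p2. is_biproduct C A B P i1 i2 p1 p2"

locale abelian_category = additive_category +
  assumes ex_kernel: "f \<in> Arr C \<Longrightarrow> \<exists>k. is_kernel C k f"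
    and ex_cokernel: "f \<in> Arr C \<Longrightarrow> \<exists>q. is_cokernel C q f"
    and mono_normal: "monic C f \<Longrightarrow> \<exists>g. is_kernel C f g"
    and epi_normal: "epic C f \<Longrightarrow> \<exists>g. is_cokernel C f g"

definition short_exact ::
    "('o, 'm) precat \<Rightarrow> 'o \<Rightarrow> 'm \<Rightarrow> 'o \<Rightarrow> 'm \<Rightarrow> 'o \<Rightarrow> bool" where
  "short_exact C L f M g N \<longleftrightarrow>
     f \<in> Hom C L M \<and> g \<in> Hom C M N \<and> is_kernel C f g \<and> is_cokernel C g f"

definition simple_object :: "('o, 'm) precat \<Rightarrow> 'o \<Rightarrow> bool" where
  "simple_object C S \<longleftrightarrow> S \<in> Obj C \<and> \<not> zero_object C S \<and>
     (\<forall>L. \<forall>f \<in> Hom C L S. monic C f \<longrightarrow> zero_object C L \<or> is_iso C f)"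

text \<open>Finite length: there is a composition series
  \<open>0 = M 0 \<subseteq> M 1 \<subseteq> \<dots> \<subseteq> M n = A\<close> with simple quotients.\<close>

definition finite_length :: "('o, 'm) precat \<Rightarrow> 'o \<Rightarrow> bool" where
  "finite_length C A \<longleftrightarrow>
     (\<exists>(n :: nat) M. zero_object C (M 0) \<and> M n = A \<and>
        (\<forall>k < n. \<exists>f g S. short_exact C (M k) f (M (Suc k)) g S \<and> simple_object C S))"

locale length_abelian_category = abelian_category +
  assumes Obj_finite_length: "A \<in> Obj C \<Longrightarrow> finite_length C A"


section \<open>Functors, adjunctions and recollements\<close>

record ('o, 'm, 'p, 'n) fctr =
  obj_map :: "'o \<Rightarrow> 'p"
  arr_map :: "'m \<Rightarrow> 'n"

locale cat_functor =
  fixes C :: "('o, 'm) precat" and D :: "('p, 'n) precat" and F :: "('o, 'm, 'p, 'n) fctr"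
  assumes obj_map_in: "A \<in> Obj C \<Longrightarrow> obj_map F A \<in> Obj D"
    and arr_map_in: "f \<in> Hom C A B \<Longrightarrow> arr_map F f \<in> Hom D (obj_map F A) (obj_map F B)"
    and arr_map_Id: "A \<in> Obj C \<Longrightarrow> arr_map F (Id C A) = Id D (obj_map F A)"
    and arr_map_Comp: "\<lbrakk>f \<in> Hom C A B; g \<in> Hom C B E\<rbrakk>
      \<Longrightarrow> arr_map F (g \<cdot>\<^bsub>C\<^esub> f) = arr_map F g \<cdot>\<^bsub>D\<^esub> arr_map F f"

definition fully_faithful ::
    "('o, 'm) precat \<Rightarrow> ('p, 'n) precat \<Rightarrow> ('o, 'm, 'p, 'n) fctr \<Rightarrow> bool" where
  "fully_faithful C D F \<longleftrightarrow>
     (\<forall>A \<in> Obj C. \<forall>B \<in> Obj C.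
        bij_betw (arr_map F) (Hom C A B) (Hom D (obj_map F A) (obj_map F B)))"

text \<open>\<open>adjoint_pair C D F G\<close>: the functor \<open>F\<close> from \<open>C\<close> to \<open>D\<close> is left adjoint to \<open>G\<close> from \<open>D\<close> to
  \<open>C\<close>, via bijections \<open>\<phi> A B\<close> from \<open>Hom D (F A) B\<close> to \<open>Hom C A (G B)\<close> natural in \<open>A\<close> and \<open>B\<close>.\<close>

definition adjoint_pair ::
    "('o, 'm) precat \<Rightarrow> ('p, 'n) precat \<Rightarrow> ('o, 'm, 'p, 'n) fctr \<Rightarrow> ('p, 'n, 'o, 'm) fctr \<Rightarrow> bool" where
  "adjoint_pair C D F G \<longleftrightarrow>
     (\<exists>\<phi>. (\<forall>A \<in> Obj C. \<forall>B \<in> Obj D.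
             bij_betw (\<phi> A B) (Hom D (obj_map F A) B) (Hom C A (obj_map G B))) \<and>
          (\<forall>A \<in> Obj C. \<forall>A' \<in> Obj C. \<forall>B \<in> Obj D. \<forall>B' \<in> Obj D.
             \<forall>a \<in> Hom C A' A. \<forall>b \<in> Hom D B B'. \<forall>h \<in> Hom D (obj_map F A) B.
               \<phi> A' B' (b \<cdot>\<^bsub>D\<^esub> h \<cdot>\<^bsub>D\<^esub> arr_map F a)
                 = arr_map G b \<cdot>\<^bsub>C\<^esub> \<phi> A B h \<cdot>\<^bsub>C\<^esub> a))"

definition exact_functor ::
    "('o, 'm) precat \<Rightarrow> ('p, 'n) precat \<Rightarrow> ('o, 'm, 'p, 'n) fctr \<Rightarrow> bool" where
  "exact_functor C D F \<longleftrightarrow>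
     (\<forall>L f M g N. short_exact C L f M g N \<longrightarrow>
        short_exact D (obj_map F L) (arr_map F f) (obj_map F M) (arr_map F g) (obj_map F N))"

definition essential_image ::
    "('o, 'm) precat \<Rightarrow> ('p, 'n) precat \<Rightarrow> ('o, 'm, 'p, 'n) fctr \<Rightarrow> 'p set" where
  "essential_image C D F = {B \<in> Obj D. \<exists>A \<in> Obj C. isomorphic D (obj_map F A) B}"

definition functor_kernel ::
    "('o, 'm) precat \<Rightarrow> ('p, 'n) precat \<Rightarrow> ('o, 'm, 'p, 'n) fctr \<Rightarrow> 'o set" where
  "functor_kernel C D F = {A \<in> Obj C. zero_object D (obj_map F A)}"

text \<open>A recollement of \<open>X\<close> relative to \<open>Y\<close> and \<open>Z\<close>. The functors are called \<open>i_star\<close> (for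
  \<open>i\<^sup>*\<close>), \<open>i_lstar\<close> (for \<open>i\<^sub>*\<close>), \<open>i_shriek\<close> (for \<open>i\<^sup>!\<close>), \<open>j_lshriek\<close> (for
  \<open>j\<^sub>!\<close>), \<open>j_star\<close> (for \<open>j\<^sup>*\<close>) and \<open>j_lstar\<close> (for \<open>j\<^sub>*\<close>).\<close>

locale recollement =
  Y: abelian_category Y + X: abelian_category X + Z: abelian_category Z +
  i_star: cat_functor X Y i_star +
  i_lstar: cat_functor Y X i_lstar +
  i_shriek: cat_functor X Y i_shriek +
  j_lshriek: cat_functor Z X j_lshriek +
  j_star: cat_functor X Z j_star +
  j_lstar: cat_functor Z X j_lstar
  for Y :: "('oy, 'my) precat" and X :: "('ox, 'mx) precat" and Z :: "('oz, 'mz) precat"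
    and i_star :: "('ox, 'mx, 'oy, 'my) fctr"
    and i_lstar :: "('oy, 'my, 'ox, 'mx) fctr"
    and i_shriek :: "('ox, 'mx, 'oy, 'my) fctr"
    and j_lshriek :: "('oz, 'mz, 'ox, 'mx) fctr"
    and j_star :: "('ox, 'mx, 'oz, 'mz) fctr"
    and j_lstar :: "('oz, 'mz, 'ox, 'mx) fctr" +
  assumes adj_i_star_i_lstar: "adjoint_pair X Y i_star i_lstar"
    and adj_i_lstar_i_shriek: "adjoint_pair Y X i_lstar i_shriek"
    and adj_j_lshriek_j_star: "adjoint_pair Z X j_lshriek j_star"
    and adj_j_star_j_lstar: "adjoint_pair X Z j_star j_lstar"
    and ff_i_lstar: "fully_faithful Y X i_lstar"
    and ff_j_lshriek: "fully_faithful Z X j_lshriek"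
    and ff_j_lstar: "fully_faithful Z X j_lstar"
    and image_eq_kernel: "essential_image Y X i_lstar = functor_kernel X Z j_star"


section \<open>Left Schur subcategories\<close>

text \<open>Full subcategories are represented by their sets of objects.\<close>

definition subcategory :: "('o, 'm) precat \<Rightarrow> 'o set \<Rightarrow> bool" where
  "subcategory C E \<longleftrightarrow> E \<subseteq> Obj C \<and> (\<exists>Z \<in> E. zero_object C Z) \<and>
     (\<forall>A \<in> E. \<forall>B \<in> Obj C. isomorphic C A B \<longrightarrow> B \<in> E)"

definition extension_closed :: "('o, 'm) precat \<Rightarrow> 'o set \<Rightarrow> bool" where
  "extension_closed C E \<longleftrightarrow>
     (\<forall>L f M g N. short_exact C L f M g N \<longrightarrow> L \<in> E \<longrightarrow> N \<in> E \<longrightarrow> M \<in> E)"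

definition simple_in :: "('o, 'm) precat \<Rightarrow> 'o set \<Rightarrow> 'o \<Rightarrow> bool" where
  "simple_in C E M \<longleftrightarrow> M \<in> E \<and> \<not> zero_object C M \<and>
     \<not> (\<exists>L f g N. short_exact C L f M g N \<and> L \<in> E \<and> N \<in> E \<and>
           \<not> zero_object C L \<and> \<not> zero_object C N)"

definition left_schurian :: "('o, 'm) precat \<Rightarrow> 'o set \<Rightarrow> 'o \<Rightarrow> bool" where
  "left_schurian C E M \<longleftrightarrow> M \<in> Obj C \<and> \<not> zero_object C M \<and>
     (\<forall>B \<in> E. \<forall>f \<in> Hom C M B. f = hzero C M B \<or> monic C f)"

definition left_schur :: "('o, 'm) precat \<Rightarrow> 'o set \<Rightarrow> bool" where
  "left_schur C E \<longleftrightarrow> extension_closed C E \<and> (\<forall>M. simple_in C E M \<longrightarrow> left_schurian C E M)"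

end

theory Submission
  imports Defs
begin

text \<open>
  If \<open>i\<^sup>!\<close> is exact, then \<open>i\<^sup>! j\<^sub>* = 0\<close> forces every unit \<open>M \<rightarrow> j\<^sub>* j\<^sup>* M\<close> to be epic: its cokernel is
  killed by both \<open>j\<^sup>*\<close> and \<open>i\<^sup>!\<close>. So each \<open>M\<close> is an extension of \<open>j\<^sub>* j\<^sup>* M\<close> by an object killed
  by \<open>j\<^sup>*\<close>, and if \<open>M\<close> lies in \<open>E_X\<close> then so do both ends. Hence a simple object \<open>M\<close> of
  \<open>E_X\<close> satisfies \<open>j\<^sup>* M = 0\<close> or \<open>i\<^sup>! M = 0\<close>, that is, it comes from a simple object of \<open>E_Y\<close> via \<open>i\<^sub>*\<close> or
  of \<open>E_Z\<close> via \<open>j\<^sub>*\<close>, and all these functors are exact. On objects killed by one of the two exact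
  functors \<open>i\<^sup>!\<close>, \<open>j\<^sup>*\<close>, the other one detects zero morphisms and monomorphisms, because only the
  zero object is killed by both.
\<close>

section \<open>Abelian categories\<close>

lemma HomD:
  assumes "f \<in> Hom C A B"
  shows "f \<in> Arr C" "Dom C f = A" "Cod C f = B"
  using assms by (auto simp: Hom_def)

lemma monic_iff:
  "f \<in> Hom C A B \<Longrightarrow> monic C f \<longleftrightarrow>
     (\<forall>D. \<forall>g \<in> Hom C D A. \<forall>h \<in> Hom C D A. f \<cdot>\<^bsub>C\<^esub> g = f \<cdot>\<^bsub>C\<^esub> h \<longrightarrow> g = h)"
  by (auto simp: monic_def Hom_def)

lemma epic_iff:
  "f \<in> Hom C A B \<Longrightarrow> epic C f \<longleftrightarrow>
     (\<forall>D. \<forall>g \<in> Hom C B D. \<forall>h \<in> Hom C B D. g \<cdot>\<^bsub>C\<^esub> f = h \<cdot>\<^bsub>C\<^esub> f \<longrightarrow> g = h)"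
  by (auto simp: epic_def Hom_def)

lemma isomorphic_iff:
  "isomorphic C A B \<longleftrightarrow>
     (\<exists>f \<in> Hom C A B. \<exists>g \<in> Hom C B A. g \<cdot>\<^bsub>C\<^esub> f = Id C A \<and> f \<cdot>\<^bsub>C\<^esub> g = Id C B)"
  unfolding isomorphic_def is_iso_def by (intro bex_cong refl) (simp add: HomD)

lemma isomorphicI:
  assumes "f \<in> Hom C A B" "g \<in> Hom C B A" "g \<cdot>\<^bsub>C\<^esub> f = Id C A" "f \<cdot>\<^bsub>C\<^esub> g = Id C B"
  shows "isomorphic C A B"
  unfolding isomorphic_iff using assms by blast

lemma isomorphic_sym: "isomorphic C A B \<Longrightarrow> isomorphic C B A"
  unfolding isomorphic_iff by blast

lemma is_kernel_iff:
  assumes "k \<in> Hom C L M" "f \<in> Hom C M N"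
  shows "is_kernel C k f \<longleftrightarrow> f \<cdot>\<^bsub>C\<^esub> k = hzero C L N \<and>
    (\<forall>A. \<forall>h \<in> Hom C A M. f \<cdot>\<^bsub>C\<^esub> h = hzero C A N \<longrightarrow>
       (\<exists>!u. u \<in> Hom C A L \<and> k \<cdot>\<^bsub>C\<^esub> u = h))"
  using assms unfolding is_kernel_def by (simp add: HomD)

lemma is_cokernel_iff:
  assumes "q \<in> Hom C M N" "f \<in> Hom C L M"
  shows "is_cokernel C q f \<longleftrightarrow> q \<cdot>\<^bsub>C\<^esub> f = hzero C L N \<and>
    (\<forall>B. \<forall>h \<in> Hom C M B. h \<cdot>\<^bsub>C\<^esub> f = hzero C L B \<longrightarrow>
       (\<exists>!u. u \<in> Hom C N B \<and> u \<cdot>\<^bsub>C\<^esub> q = h))"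
  using assms unfolding is_cokernel_def by (simp add: HomD)

section \<open>Isomorphisms, and composition of monomorphisms and epimorphisms\<close>

context category
begin

lemma Hom_Obj:
  assumes "f \<in> Hom C A B"
  shows "A \<in> Obj C" "B \<in> Obj C"
  using assms Dom_in Cod_in by (auto simp: Hom_def)

lemma isomorphic_Obj:
  assumes "isomorphic C A B"
  shows "A \<in> Obj C" "B \<in> Obj C"
  using assms Hom_Obj unfolding isomorphic_iff by blast+

lemma subcategory_isomorphic:
  "\<lbrakk>subcategory C E; A \<in> E; isomorphic C A B\<rbrakk> \<Longrightarrow> B \<in> E"
  using isomorphic_Obj(2) unfolding subcategory_def by blast

lemma isomorphic_refl: "A \<in> Obj C \<Longrightarrow> isomorphic C A A"
  using Id_in Comp_Id isomorphicI by metis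

lemma isomorphic_trans:
  assumes "isomorphic C A B" "isomorphic C B D"
  shows "isomorphic C A D"
proof -
  obtain f g where f: "f \<in> Hom C A B" "g \<in> Hom C B A" "g \<cdot> f = Id C A" "f \<cdot> g = Id C B"
    using assms(1) unfolding isomorphic_iff by blast
  obtain f' g' where f': "f' \<in> Hom C B D" "g' \<in> Hom C D B" "g' \<cdot> f' = Id C B" "f' \<cdot> g' = Id C D"
    using assms(2) unfolding isomorphic_iff by blast
  have ff: "f' \<cdot> f \<in> Hom C A D" and gg: "g \<cdot> g' \<in> Hom C D A"
    using Comp_in[OF f(1) f'(1)] Comp_in[OF f'(2) f(2)] by auto
  have "g' \<cdot> (f' \<cdot> f) = f" "f \<cdot> (g \<cdot> g') = g'"
    using Comp_assoc[OF f(1) f'(1,2)] Comp_assoc[OF f'(2) f(2,1)] f(4) f'(3)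
      Id_Comp[OF f(1)] Id_Comp[OF f'(2)] by auto
  then have "(g \<cdot> g') \<cdot> (f' \<cdot> f) = Id C A" "(f' \<cdot> f) \<cdot> (g \<cdot> g') = Id C D"
    using Comp_assoc[OF ff f'(2) f(2)] Comp_assoc[OF gg f(1) f'(1)] f(3) f'(4) by auto
  then show ?thesis
    using isomorphicI[OF ff gg] by simp
qed

lemma section_monic:
  assumes f: "f \<in> Hom C A B" and g: "g \<in> Hom C B A" "g \<cdot> f = Id C A"
  shows "monic C f"
  unfolding monic_iff[OF f]
proof (intro allI ballI impI)
  fix D h h'
  assume h: "h \<in> Hom C D A" "h' \<in> Hom C D A" "f \<cdot> h = f \<cdot> h'"
  have "g \<cdot> (f \<cdot> h) = h" "g \<cdot> (f \<cdot> h') = h'"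
    using Comp_assoc[OF h(1) f g(1)] Comp_assoc[OF h(2) f g(1)] g(2) Id_Comp[OF h(1)] Id_Comp[OF h(2)] by auto
  then show "h = h'"
    using h(3) by metis
qed

lemma retraction_epic:
  assumes f: "f \<in> Hom C A B" and g: "g \<in> Hom C B A" "f \<cdot> g = Id C B"
  shows "epic C f"
  unfolding epic_iff[OF f]
proof (intro allI ballI impI)
  fix D h h'
  assume h: "h \<in> Hom C B D" "h' \<in> Hom C B D" "h \<cdot> f = h' \<cdot> f"
  have "(h \<cdot> f) \<cdot> g = h" "(h' \<cdot> f) \<cdot> g = h'"
    using Comp_assoc[OF g(1) f h(1)] Comp_assoc[OF g(1) f h(2)] g(2) Comp_Id[OF h(1)] Comp_Id[OF h(2)] by auto
  then show "h = h'"
    using h(3) by metis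
qed

lemma monic_Comp:
  assumes m: "monic C f" "monic C g" and f: "f \<in> Hom C A B" and g: "g \<in> Hom C B D"
  shows "monic C (g \<cdot> f)"
  unfolding monic_iff[OF Comp_in[OF f g]]
proof (intro allI ballI impI)
  fix E h h'
  assume h: "h \<in> Hom C E A" "h' \<in> Hom C E A" "(g \<cdot> f) \<cdot> h = (g \<cdot> f) \<cdot> h'"
  then have "g \<cdot> (f \<cdot> h) = g \<cdot> (f \<cdot> h')"
    using Comp_assoc[OF h(1) f g] Comp_assoc[OF h(2) f g] by simp
  then have "f \<cdot> h = f \<cdot> h'"
    using m(2) Comp_in[OF h(1) f] Comp_in[OF h(2) f] unfolding monic_iff[OF g] by blast
  then show "h = h'"
    using m(1) h unfolding monic_iff[OF f] by blast
qed

lemma epic_Comp: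
  assumes m: "epic C f" "epic C g" and f: "f \<in> Hom C A B" and g: "g \<in> Hom C B D"
  shows "epic C (g \<cdot> f)"
  unfolding epic_iff[OF Comp_in[OF f g]]
proof (intro allI ballI impI)
  fix E h h'
  assume h: "h \<in> Hom C D E" "h' \<in> Hom C D E" "h \<cdot> (g \<cdot> f) = h' \<cdot> (g \<cdot> f)"
  then have "(h \<cdot> g) \<cdot> f = (h' \<cdot> g) \<cdot> f"
    using Comp_assoc[OF f g h(1)] Comp_assoc[OF f g h(2)] by simp
  then have "h \<cdot> g = h' \<cdot> g"
    using m(1) Comp_in[OF g h(1)] Comp_in[OF g h(2)] unfolding epic_iff[OF f] by blast
  then show "h = h'"
    using m(2) h unfolding epic_iff[OF g] by blast
qed

end

section \<open>Zero morphisms, zero objects, kernels and cokernels\<close>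

context preadditive_category
begin

lemma hzero_in: "\<lbrakk>A \<in> Obj C; B \<in> Obj C\<rbrakk> \<Longrightarrow> hzero C A B \<in> Hom C A B"
  using group.is_monoid[OF comm_group.axioms(2)[OF Hom_comm_group]] monoid.one_closed by fastforce

text \<open>The only idempotent of a group is its neutral element. With distributivity of
  composition this yields that composites with zero morphisms vanish.\<close>

lemma hadd_self_eq:
  assumes "f \<in> Hom C A B" "hadd C f f = f"
  shows "f = hzero C A B"
proof -
  interpret G: comm_group "\<lparr>carrier = Hom C A B, mult = hadd C, one = hzero C A B\<rparr>"
    using Hom_comm_group Hom_Obj assms(1) by blast
  show ?thesis
    using G.r_cancel_one'[of f f] assms by simp
qed

lemma Comp_hzero:
  assumes "g \<in> Hom C B D" "A \<in> Obj C"
  shows "g \<cdot> hzero C A B = hzero C A D"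
proof -
  have z: "hzero C A B \<in> Hom C A B"
    using assms Hom_Obj hzero_in by blast
  interpret G: comm_group "\<lparr>carrier = Hom C A B, mult = hadd C, one = hzero C A B\<rparr>"
    using Hom_comm_group Hom_Obj assms by blast
  have "hadd C (hzero C A B) (hzero C A B) = hzero C A B"
    using G.l_one[of "hzero C A B"] z by simp
  then show ?thesis
    using Comp_hadd_right[OF z z assms(1)] hadd_self_eq Comp_in z assms(1) by metis
qed

lemma hzero_Comp:
  assumes "f \<in> Hom C A B" "D \<in> Obj C"
  shows "hzero C B D \<cdot> f = hzero C A D"
proof -
  have z: "hzero C B D \<in> Hom C B D"
    using assms Hom_Obj hzero_in by blast
  interpret G: comm_group "\<lparr>carrier = Hom C B D, mult = hadd C, one = hzero C B D\<rparr>"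
    using Hom_comm_group Hom_Obj assms by blast
  have "hadd C (hzero C B D) (hzero C B D) = hzero C B D"
    using G.l_one[of "hzero C B D"] z by simp
  then show ?thesis
    using Comp_hadd_left[OF assms(1) z z] hadd_self_eq Comp_in z assms(1) by metis
qed

text \<open>The difference of \<open>g\<close> and \<open>h\<close> is characterised by an equation
  in \<open>hadd\<close>, so that group inverses stay confined to this proof.\<close>

lemma ex_hdiff:
  assumes "g \<in> Hom C A B" "h \<in> Hom C A B"
  obtains d where "d \<in> Hom C A B" "hadd C d h = g"
proof -
  interpret G: comm_group "\<lparr>carrier = Hom C A B, mult = hadd C, one = hzero C A B\<rparr>"
    using Hom_comm_group Hom_Obj assms by blast
  let ?G = "\<lparr>carrier = Hom C A B, mult = hadd C, one = hzero C A B\<rparr>"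
  have "inv\<^bsub>?G\<^esub> h \<in> Hom C A B"
    using G.inv_closed[of h] assms by simp
  then have "hadd C (hadd C g (inv\<^bsub>?G\<^esub> h)) h = g"
    using G.m_assoc[of g "inv\<^bsub>?G\<^esub> h" h] G.l_inv[of h] G.r_one[of g] assms by simp
  then show thesis
    using that[of "hadd C g (inv\<^bsub>?G\<^esub> h)"] G.m_closed[of g "inv\<^bsub>?G\<^esub> h"] \<open>inv\<^bsub>?G\<^esub> h \<in> Hom C A B\<close> assms by simp
qed

lemma hzero_hadd:
  assumes "f \<in> Hom C A B"
  shows "hadd C (hzero C A B) f = f"
proof -
  interpret G: comm_group "\<lparr>carrier = Hom C A B, mult = hadd C, one = hzero C A B\<rparr>"
    using Hom_comm_group Hom_Obj assms by blast
  show ?thesis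
    using G.l_one[of f] assms by simp
qed

lemma hadd_eq_right:
  assumes "d \<in> Hom C A B" "h \<in> Hom C A B" "hadd C d h = h"
  shows "d = hzero C A B"
proof -
  interpret G: comm_group "\<lparr>carrier = Hom C A B, mult = hadd C, one = hzero C A B\<rparr>"
    using Hom_comm_group Hom_Obj assms by blast
  show ?thesis
    using G.r_cancel_one[of h d] assms by simp
qed

text \<open>If \<open>f\<close> equalises \<open>g\<close> and \<open>h\<close>, distributivity
  shows that it kills their difference, so testing against zero suffices.\<close>

lemma monicI_zero:
  assumes f: "f \<in> Hom C A B"
    and z: "\<And>D g. \<lbrakk>g \<in> Hom C D A; f \<cdot> g = hzero C D B\<rbrakk> \<Longrightarrow> g = hzero C D A"
  shows "monic C f"
  unfolding monic_iff[OF f]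
proof (intro allI ballI impI)
  fix D g h
  assume gh: "g \<in> Hom C D A" "h \<in> Hom C D A" "f \<cdot> g = f \<cdot> h"
  obtain d where d: "d \<in> Hom C D A" "hadd C d h = g"
    using ex_hdiff gh by blast
  have "hadd C (f \<cdot> d) (f \<cdot> h) = f \<cdot> h"
    using Comp_hadd_right[OF d(1) gh(2) f] d gh by simp
  then have "f \<cdot> d = hzero C D B"
    using hadd_eq_right Comp_in d gh f by metis
  then show "g = h"
    using z d gh hzero_hadd by metis
qed

lemma epicI_zero:
  assumes f: "f \<in> Hom C A B"
    and z: "\<And>D g. \<lbrakk>g \<in> Hom C B D; g \<cdot> f = hzero C A D\<rbrakk> \<Longrightarrow> g = hzero C B D"
  shows "epic C f"
  unfolding epic_iff[OF f]
proof (intro allI ballI impI)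
  fix D g h
  assume gh: "g \<in> Hom C B D" "h \<in> Hom C B D" "g \<cdot> f = h \<cdot> f"
  obtain d where d: "d \<in> Hom C B D" "hadd C d h = g"
    using ex_hdiff gh by blast
  have "hadd C (d \<cdot> f) (h \<cdot> f) = h \<cdot> f"
    using Comp_hadd_left[OF f d(1) gh(2)] d gh by simp
  then have "d \<cdot> f = hzero C A D"
    using hadd_eq_right Comp_in d gh f by metis
  then show "g = h"
    using z d gh hzero_hadd by metis
qed

lemma monic_cancel_zero:
  assumes "monic C f" "f \<in> Hom C A B" "g \<in> Hom C D A" "f \<cdot> g = hzero C D B"
  shows "g = hzero C D A"
proof -
  have "D \<in> Obj C" "A \<in> Obj C"
    using assms Hom_Obj by blast+
  then show ?thesis
    using assms(1,3,4) hzero_in Comp_hzero[OF assms(2)] unfolding monic_iff[OF assms(2)] by metis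
qed

lemma epic_cancel_zero:
  assumes "epic C f" "f \<in> Hom C A B" "g \<in> Hom C B D" "g \<cdot> f = hzero C A D"
  shows "g = hzero C B D"
proof -
  have "D \<in> Obj C" "B \<in> Obj C"
    using assms Hom_Obj by blast+
  then show ?thesis
    using assms(1,3,4) hzero_in hzero_Comp[OF assms(2)] unfolding epic_iff[OF assms(2)] by metis
qed

text \<open>Every morphism into or out of \<open>A\<close> factors through the identity of
  \<open>A\<close>, hence vanishes when that identity does. This replaces the universal property by
  an equation that functors and adjunctions can transport.\<close>

lemma zero_object_iff: "zero_object C A \<longleftrightarrow> A \<in> Obj C \<and> Id C A = hzero C A A"
proof
  assume "zero_object C A"
  then show "A \<in> Obj C \<and> Id C A = hzero C A A"
    using Id_in hzero_in unfolding zero_object_def by metis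
next
  assume A: "A \<in> Obj C \<and> Id C A = hzero C A A"
  have "f = hzero C B A" if "f \<in> Hom C B A" for f B
    using that Id_Comp hzero_Comp A by metis
  moreover have "f = hzero C A B" if "f \<in> Hom C A B" for f B
    using that Comp_Id Comp_hzero A by metis
  ultimately show "zero_object C A"
    unfolding zero_object_def using A hzero_in by metis
qed

lemma Hom_to_zero: "\<lbrakk>zero_object C B; f \<in> Hom C A B\<rbrakk> \<Longrightarrow> f = hzero C A B"
  using Id_Comp hzero_Comp unfolding zero_object_iff by metis

lemma Hom_from_zero: "\<lbrakk>zero_object C A; f \<in> Hom C A B\<rbrakk> \<Longrightarrow> f = hzero C A B"
  using Comp_Id Comp_hzero unfolding zero_object_iff by metis

lemma zero_object_monic:
  assumes "monic C f" "f \<in> Hom C A B" "f = hzero C A B"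
  shows "zero_object C A"
  using assms monic_cancel_zero[OF assms(1,2)] Id_in Comp_Id Hom_Obj unfolding zero_object_iff by metis

lemma zero_object_epic:
  assumes "epic C f" "f \<in> Hom C A B" "f = hzero C A B"
  shows "zero_object C B"
  using assms epic_cancel_zero[OF assms(1,2)] Id_in Id_Comp Hom_Obj unfolding zero_object_iff by metis

lemma zero_object_isomorphic:
  assumes "isomorphic C A B" "zero_object C A"
  shows "zero_object C B"
proof -
  obtain f g where f: "f \<in> Hom C A B" "g \<in> Hom C B A" "g \<cdot> f = Id C A" "f \<cdot> g = Id C B"
    using assms(1) unfolding isomorphic_iff by blast
  then have "f \<cdot> g = hzero C B B"
    using Hom_from_zero[OF assms(2) f(1)] hzero_Comp Hom_Obj by metis
  then show ?thesis
    using f Hom_Obj unfolding zero_object_iff by metis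
qed

lemma zero_objects_isomorphic:
  assumes A: "zero_object C A" and B: "zero_object C B"
  shows "isomorphic C A B"
proof -
  have obj: "A \<in> Obj C" "B \<in> Obj C"
    using A B unfolding zero_object_def by simp_all
  note h = hzero_in[OF obj] hzero_in[OF obj(2,1)] and id = Id_in[OF obj(1)] Id_in[OF obj(2)]
  show ?thesis
    using isomorphicI[OF h] Hom_from_zero[OF A Comp_in[OF h]] Hom_from_zero[OF A id(1)]
      Hom_from_zero[OF B Comp_in[OF h(2,1)]] Hom_from_zero[OF B id(2)] by simp
qed

lemma monic_to_zero: "\<lbrakk>monic C f; f \<in> Hom C A B; zero_object C B\<rbrakk> \<Longrightarrow> zero_object C A"
  using zero_object_monic Hom_to_zero by blast

lemma epic_from_zero: "\<lbrakk>epic C f; f \<in> Hom C A B; zero_object C A\<rbrakk> \<Longrightarrow> zero_object C B"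
  using zero_object_epic Hom_from_zero by blast

text \<open>Zero objects are isomorphic to each other and \<open>E\<close> is closed under
  isomorphism, so the one zero object guaranteed by \<open>subcategory\<close> brings in all
  others.\<close>

lemma subcategory_zero:
  assumes "subcategory C E" "zero_object C A"
  shows "A \<in> E"
proof -
  obtain W where W: "W \<in> E" "zero_object C W"
    using assms(1) unfolding subcategory_def by blast
  show ?thesis
    using subcategory_isomorphic[OF assms(1) W(1) zero_objects_isomorphic[OF W(2) assms(2)]] .
qed

text \<open>Uniqueness of the factorisation is exactly that \<open>k\<close> is monic, which leaves
  only existence to check.\<close>

lemma kernelI:
  assumes "k \<in> Hom C L M" "f \<in> Hom C M N" "f \<cdot> k = hzero C L N" "monic C k"
    and "\<And>A h. \<lbrakk>h \<in> Hom C A M; f \<cdot> h = hzero C A N\<rbrakk> \<Longrightarrow> \<exists>u \<in> Hom C A L. k \<cdot> u = h"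
  shows "is_kernel C k f"
  using assms(3-5) unfolding is_kernel_iff[OF assms(1,2)] monic_iff[OF assms(1)] by metis

lemma cokernelI:
  assumes "q \<in> Hom C M N" "f \<in> Hom C L M" "q \<cdot> f = hzero C L N" "epic C q"
    and "\<And>B h. \<lbrakk>h \<in> Hom C M B; h \<cdot> f = hzero C L B\<rbrakk> \<Longrightarrow> \<exists>u \<in> Hom C N B. u \<cdot> q = h"
  shows "is_cokernel C q f"
  using assms(3-5) unfolding is_cokernel_iff[OF assms(1,2)] epic_iff[OF assms(1)] by metis

lemma kernel_factor:
  assumes "is_kernel C k f" "k \<in> Hom C L M" "f \<in> Hom C M N" "h \<in> Hom C A M"
    and "f \<cdot> h = hzero C A N"
  obtains u where "u \<in> Hom C A L" "k \<cdot> u = h"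
  using assms(1,4,5) that unfolding is_kernel_iff[OF assms(2,3)] by blast

lemma cokernel_factor:
  assumes "is_cokernel C q f" "q \<in> Hom C M N" "f \<in> Hom C L M" "h \<in> Hom C M B"
    and "h \<cdot> f = hzero C L B"
  obtains u where "u \<in> Hom C N B" "u \<cdot> q = h"
  using assms(1,4,5) that unfolding is_cokernel_iff[OF assms(2,3)] by blast

lemma kernel_monic:
  assumes "is_kernel C k f"
  shows "monic C k"
proof -
  obtain L M N where k: "k \<in> Hom C L M" and f: "f \<in> Hom C M N"
    using assms by (auto simp: is_kernel_def Hom_def)
  note K = assms[unfolded is_kernel_iff[OF k f]]
  show ?thesis
    unfolding monic_iff[OF k]
  proof (intro allI ballI impI)
    fix D g h
    assume gh: "g \<in> Hom C D L" "h \<in> Hom C D L" "k \<cdot> g = k \<cdot> h"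
    have "f \<cdot> (k \<cdot> g) = hzero C D N"
      using K Comp_assoc[OF gh(1) k f] hzero_Comp gh(1) f Hom_Obj by metis
    then show "g = h"
      using K gh Comp_in k by metis
  qed
qed

lemma cokernel_epic:
  assumes "is_cokernel C q f"
  shows "epic C q"
proof -
  obtain L M N where q: "q \<in> Hom C M N" and f: "f \<in> Hom C L M"
    using assms by (auto simp: is_cokernel_def Hom_def)
  note K = assms[unfolded is_cokernel_iff[OF q f]]
  show ?thesis
    unfolding epic_iff[OF q]
  proof (intro allI ballI impI)
    fix D g h
    assume gh: "g \<in> Hom C N D" "h \<in> Hom C N D" "g \<cdot> q = h \<cdot> q"
    have "(g \<cdot> q) \<cdot> f = hzero C L D"
      using K Comp_assoc[OF f q gh(1)] Comp_hzero gh(1) f Hom_Obj by metis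
    then show "g = h"
      using K gh Comp_in q by metis
  qed
qed

lemma short_exactD:
  assumes "short_exact C L f M g N"
  shows "f \<in> Hom C L M" "g \<in> Hom C M N" "is_kernel C f g" "is_cokernel C g f"
    "monic C f" "epic C g" "g \<cdot> f = hzero C L N"
proof -
  show f: "f \<in> Hom C L M" and g: "g \<in> Hom C M N" and K: "is_kernel C f g" "is_cokernel C g f"
    using assms unfolding short_exact_def by simp_all
  show "monic C f" "epic C g" "g \<cdot> f = hzero C L N"
    using kernel_monic[OF K(1)] cokernel_epic[OF K(2)] K(1) unfolding is_kernel_iff[OF f g]
    by simp_all
qed

text \<open>Composing \<open>f\<close> with an isomorphism and \<open>g\<close> with its inverse
  keeps both universal properties. Images of sequences under functors have a middle term that is
  only isomorphic to the desired one; this lemma replaces it.\<close>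

lemma short_exact_isomorphic:
  assumes "short_exact C L f M g N" "isomorphic C M M'"
  obtains f' g' where "short_exact C L f' M' g' N"
proof -
  note S = short_exactD[OF assms(1)]
  obtain u v where u: "u \<in> Hom C M M'" "v \<in> Hom C M' M" "v \<cdot> u = Id C M" "u \<cdot> v = Id C M'"
    using assms(2) unfolding isomorphic_iff by blast
  have f': "u \<cdot> f \<in> Hom C L M'" and g': "g \<cdot> v \<in> Hom C M' N"
    using S u Comp_in by blast+
  have "g = (g \<cdot> v) \<cdot> u"
    using Comp_assoc[OF u(1,2) S(2)] u S(2) Comp_Id by simp
  then have gvu: "(g \<cdot> v) \<cdot> (u \<cdot> f) = hzero C L N"
    using Comp_assoc[OF S(1) u(1) g'] S(7) by simp
  have m: "monic C (u \<cdot> f)"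
    using monic_Comp[OF S(5) section_monic[OF u(1,2,3)] S(1) u(1)] .
  have e: "epic C (g \<cdot> v)"
    using epic_Comp[OF retraction_epic[OF u(2,1,3)] S(6) u(2) S(2)] .
  have "is_kernel C (u \<cdot> f) (g \<cdot> v)"
  proof (rule kernelI[OF f' g' gvu m])
    fix A h
    assume h: "h \<in> Hom C A M'" "(g \<cdot> v) \<cdot> h = hzero C A N"
    have "g \<cdot> (v \<cdot> h) = hzero C A N"
      using h Comp_assoc[OF h(1) u(2) S(2)] by simp
    then obtain w where w: "w \<in> Hom C A L" "f \<cdot> w = v \<cdot> h"
      using kernel_factor[OF S(3,1,2)] Comp_in h(1) u(2) by metis
    then have "(u \<cdot> f) \<cdot> w = h"
      using Comp_assoc[OF w(1) S(1) u(1)] Comp_assoc[OF h(1) u(2,1)] u(4) Id_Comp h(1) by simp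
    then show "\<exists>w \<in> Hom C A L. (u \<cdot> f) \<cdot> w = h"
      using w by blast
  qed
  moreover have "is_cokernel C (g \<cdot> v) (u \<cdot> f)"
  proof (rule cokernelI[OF g' f' gvu e])
    fix B h
    assume h: "h \<in> Hom C M' B" "h \<cdot> (u \<cdot> f) = hzero C L B"
    have "(h \<cdot> u) \<cdot> f = hzero C L B"
      using h Comp_assoc[OF S(1) u(1) h(1)] by simp
    then obtain w where w: "w \<in> Hom C N B" "w \<cdot> g = h \<cdot> u"
      using cokernel_factor[OF S(4,2,1)] Comp_in h(1) u(1) by metis
    then have "w \<cdot> (g \<cdot> v) = h"
      using Comp_assoc[OF u(2) S(2) w(1)] Comp_assoc[OF u(2,1) h(1)] u(4) Comp_Id h(1) by simp
    then show "\<exists>w \<in> Hom C N B. w \<cdot> (g \<cdot> v) = h"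
      using w by blast
  qed
  ultimately show thesis
    using that f' g' unfolding short_exact_def by blast
qed

end

section \<open>Normality, balancedness and image factorization\<close>

context abelian_category
begin

lemma obtain_kernel:
  assumes "f \<in> Hom C M N"
  obtains L k where "k \<in> Hom C L M" "is_kernel C k f"
proof -
  obtain k where "is_kernel C k f"
    using ex_kernel HomD(1)[OF assms] by blast
  moreover from this have "k \<in> Hom C (Dom C k) M"
    using assms unfolding is_kernel_def by (simp add: Hom_def)
  ultimately show thesis
    using that by blast
qed

lemma obtain_cokernel:
  assumes "f \<in> Hom C L M"
  obtains N q where "q \<in> Hom C M N" "is_cokernel C q f"
proof -
  obtain q where "is_cokernel C q f"
    using ex_cokernel HomD(1)[OF assms] by blast
  moreover from this have "q \<in> Hom C M (Cod C q)"
    using assms unfolding is_cokernel_def by (simp add: Hom_def)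
  ultimately show thesis
    using that by blast
qed

text \<open>Normality makes \<open>f\<close> the kernel of some \<open>g\<close>. Since
  \<open>g\<close> kills \<open>f\<close>, it factors through the cokernel \<open>q\<close>, so
  whatever \<open>q\<close> kills is also killed by \<open>g\<close> and factors through
  \<open>f\<close>.\<close>

lemma monic_is_kernel:
  assumes f: "f \<in> Hom C L M" and "monic C f" and q: "q \<in> Hom C M N" "is_cokernel C q f"
  shows "is_kernel C f q"
proof -
  obtain g where g: "is_kernel C f g"
    using mono_normal assms by blast
  then obtain D where D: "g \<in> Hom C M D"
    using f unfolding is_kernel_def by (auto simp: Hom_def)
  have "g \<cdot> f = hzero C L D" "q \<cdot> f = hzero C L N"
    using g q is_kernel_iff[OF f D] is_cokernel_iff[OF q(1) f] by blast+
  then obtain w where w: "w \<in> Hom C N D" "w \<cdot> q = g"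
    using cokernel_factor[OF q(2,1) f D] by blast
  show ?thesis
  proof (rule kernelI[OF f q(1)])
    fix A h
    assume h: "h \<in> Hom C A M" "q \<cdot> h = hzero C A N"
    have "g \<cdot> h = hzero C A D"
      using Comp_assoc[OF h(1) q(1) w(1)] w h Comp_hzero Hom_Obj by metis
    then show "\<exists>u \<in> Hom C A L. f \<cdot> u = h"
      using kernel_factor[OF g f D h(1)] by blast
  qed fact+
qed

lemma epic_is_cokernel:
  assumes f: "f \<in> Hom C M N" and "epic C f" and k: "k \<in> Hom C L M" "is_kernel C k f"
  shows "is_cokernel C f k"
proof -
  obtain g where g: "is_cokernel C f g"
    using epi_normal assms by blast
  then obtain D where D: "g \<in> Hom C D M"
    using f unfolding is_cokernel_def by (auto simp: Hom_def)
  have "f \<cdot> g = hzero C D N" "f \<cdot> k = hzero C L N"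
    using g k is_cokernel_iff[OF f D] is_kernel_iff[OF k(1) f] by blast+
  then obtain w where w: "w \<in> Hom C D L" "k \<cdot> w = g"
    using kernel_factor[OF k(2,1) f D] by blast
  show ?thesis
  proof (rule cokernelI[OF f k(1)])
    fix A h
    assume h: "h \<in> Hom C M A" "h \<cdot> k = hzero C L A"
    have "h \<cdot> g = hzero C D A"
      using Comp_assoc[OF w(1) k(1) h(1)] w h hzero_Comp Hom_Obj by metis
    then show "\<exists>u \<in> Hom C N A. u \<cdot> f = h"
      using cokernel_factor[OF g f D h(1)] by blast
  qed fact+
qed

lemma short_exact_monic:
  assumes "f \<in> Hom C L M" "monic C f"
  obtains g N where "short_exact C L f M g N"
  using obtain_cokernel[OF assms(1)] monic_is_kernel[OF assms] assms(1) that
  unfolding short_exact_def by metis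

lemma short_exact_epic:
  assumes "g \<in> Hom C M N" "epic C g"
  obtains L f where "short_exact C L f M g N"
  using obtain_kernel[OF assms(1)] epic_is_cokernel[OF assms] assms(1) that
  unfolding short_exact_def by metis

text \<open>The cokernel \<open>g\<close> of \<open>f\<close> vanishes because \<open>f\<close> is
  epic, and \<open>f\<close> is the kernel of \<open>g\<close>, so the identity of \<open>B\<close>
  factors through \<open>f\<close>.\<close>

lemma monic_epic_isomorphic:
  assumes f: "f \<in> Hom C A B" and m: "monic C f" and e: "epic C f"
  shows "isomorphic C A B"
proof -
  obtain g N where S: "short_exact C A f B g N"
    using short_exact_monic f m by blast
  note S = short_exactD[OF S]
  have B: "Id C B \<in> Hom C B B" "g = hzero C B N"
    using epic_cancel_zero[OF e f S(2,7)] f Hom_Obj Id_in by blast+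
  then obtain u where u: "u \<in> Hom C B A" "f \<cdot> u = Id C B"
    using kernel_factor[OF S(3,1,2) B(1)] Comp_Id S(2) by metis
  have "f \<cdot> (u \<cdot> f) = f \<cdot> Id C A"
    using Comp_assoc[OF f u(1) f] u(2) Id_Comp[OF f] Comp_Id[OF f] by simp
  then have "u \<cdot> f = Id C A"
    using m Comp_in[OF f u(1)] Id_in Hom_Obj f unfolding monic_iff[OF f] by metis
  then show ?thesis
    using isomorphicI f u by metis
qed

lemma short_exact_zero_right:
  assumes "short_exact C L f M g N" "zero_object C N"
  shows "isomorphic C L M"
proof -
  note S = short_exactD[OF assms(1)]
  have "epic C f"
  proof (rule epicI_zero[OF S(1)])
    fix D h
    assume h: "h \<in> Hom C M D" "h \<cdot> f = hzero C L D"
    obtain u where "u \<in> Hom C N D" "u \<cdot> g = h"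
      using cokernel_factor[OF S(4,2,1) h] .
    then show "h = hzero C M D"
      using Hom_from_zero[OF assms(2)] hzero_Comp[OF S(2)] Hom_Obj by metis
  qed
  then show ?thesis
    using monic_epic_isomorphic S by blast
qed

lemma short_exact_zero_left:
  assumes "short_exact C L f M g N" "zero_object C L"
  shows "isomorphic C M N"
proof -
  note S = short_exactD[OF assms(1)]
  have "monic C g"
  proof (rule monicI_zero[OF S(2)])
    fix D h
    assume h: "h \<in> Hom C D M" "g \<cdot> h = hzero C D N"
    obtain u where "u \<in> Hom C D L" "f \<cdot> u = h"
      using kernel_factor[OF S(3,1,2) h] .
    then show "h = hzero C D M"
      using Hom_to_zero[OF assms(2)] Comp_hzero[OF S(1)] Hom_Obj by metis
  qed
  then show ?thesis
    using monic_epic_isomorphic S by blast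
qed

lemma monic_kernel_zero:
  assumes f: "f \<in> Hom C A B" and k: "k \<in> Hom C K A" "is_kernel C k f" and "zero_object C K"
  shows "monic C f"
proof (rule monicI_zero[OF f])
  fix D h
  assume h: "h \<in> Hom C D A" "f \<cdot> h = hzero C D B"
  obtain u where "u \<in> Hom C D K" "k \<cdot> u = h"
    using kernel_factor[OF k(2,1) f h] .
  then show "h = hzero C D A"
    using Hom_to_zero[OF assms(4)] Comp_hzero[OF k(1)] Hom_Obj by metis
qed

lemma epic_cokernel_zero:
  assumes f: "f \<in> Hom C A B" and q: "q \<in> Hom C B Q" "is_cokernel C q f" and "zero_object C Q"
  shows "epic C f"
proof (rule epicI_zero[OF f])
  fix D h
  assume h: "h \<in> Hom C B D" "h \<cdot> f = hzero C A D"
  obtain u where "u \<in> Hom C Q D" "u \<cdot> q = h"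
    using cokernel_factor[OF q(2,1) f h] .
  then show "h = hzero C B D"
    using Hom_from_zero[OF assms(4)] hzero_Comp[OF q(1)] Hom_Obj by metis
qed

text \<open>
  The image is the cokernel \<open>q\<close> of the kernel \<open>k\<close>. If \<open>f = m \<cdot> q\<close> and \<open>m \<cdot> h = 0\<close>, then \<open>m\<close> factors
  through the cokernel \<open>p\<close> of \<open>h\<close>; the kernel of the epimorphism \<open>p \<cdot> q\<close> lies in \<open>k\<close>, so \<open>q\<close> factors
  through \<open>p \<cdot> q\<close>, which makes \<open>p\<close> monic and hence \<open>h = 0\<close>.
\<close>

lemma image_factorization:
  assumes f: "f \<in> Hom C A B"
  obtains I q m where "q \<in> Hom C A I" "m \<in> Hom C I B" "epic C q" "monic C m" "m \<cdot> q = f"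
proof -
  obtain K k where k: "k \<in> Hom C K A" "is_kernel C k f"
    using obtain_kernel f by blast
  obtain I q where q: "q \<in> Hom C A I" "is_cokernel C q k"
    using obtain_cokernel k by blast
  have qe: "epic C q"
    using q cokernel_epic by blast
  have "f \<cdot> k = hzero C K B" and qk: "q \<cdot> k = hzero C K I"
    using k q is_kernel_iff[OF k(1) f] is_cokernel_iff[OF q(1) k(1)] by blast+
  then obtain m where m: "m \<in> Hom C I B" "m \<cdot> q = f"
    using cokernel_factor[OF q(2,1) k(1) f] by blast
  have "monic C m"
  proof (rule monicI_zero[OF m(1)])
    fix D h
    assume h: "h \<in> Hom C D I" "m \<cdot> h = hzero C D B"
    obtain P p where p: "p \<in> Hom C I P" "is_cokernel C p h"
      using obtain_cokernel h by blast
    obtain m' where m': "m' \<in> Hom C P B" "m' \<cdot> p = m"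
      using cokernel_factor[OF p(2,1) h(1) m(1) h(2)] .
    have pq: "p \<cdot> q \<in> Hom C A P" "epic C (p \<cdot> q)"
      using Comp_in[OF q(1) p(1)] epic_Comp[OF qe cokernel_epic[OF p(2)] q(1) p(1)] by auto
    obtain G g where S: "short_exact C G g A (p \<cdot> q) P"
      using short_exact_epic pq by blast
    note S = short_exactD[OF S]
    have "f = m' \<cdot> (p \<cdot> q)"
      using Comp_assoc[OF q(1) p(1) m'(1)] m m' by simp
    then have "f \<cdot> g = hzero C G B"
      using Comp_assoc[OF S(1) pq(1) m'(1)] S(7) Comp_hzero[OF m'(1)] S(1) Hom_Obj by metis
    then obtain g' where g': "g' \<in> Hom C G K" "k \<cdot> g' = g"
      using kernel_factor[OF k(2,1) f S(1)] by blast
    have "q \<cdot> g = hzero C G I"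
      using Comp_assoc[OF g'(1) k(1) q(1)] g' qk hzero_Comp[OF g'(1)] q(1) Hom_Obj by metis
    then obtain s where s: "s \<in> Hom C P I" "s \<cdot> (p \<cdot> q) = q"
      using cokernel_factor[OF S(4,2,1) q(1)] by blast
    have "(s \<cdot> p) \<cdot> q = Id C I \<cdot> q"
      using Comp_assoc[OF q(1) p(1) s(1)] s Id_Comp[OF q(1)] by simp
    then have "s \<cdot> p = Id C I"
      using qe Comp_in[OF p(1) s(1)] Id_in Hom_Obj p(1) unfolding epic_iff[OF q(1)] by metis
    then have "monic C p"
      using section_monic[OF p(1) s(1)] by simp
    then show "h = hzero C D I"
      using monic_cancel_zero[OF _ p(1) h(1)] p(2) is_cokernel_iff[OF p(1) h(1)] by blast
  qed
  then show thesis
    using that q m qe by blast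
qed

end

section \<open>Functors and adjunctions\<close>

locale abelian_functor =
  C: abelian_category C + D: abelian_category D + cat_functor C D F
  for C :: "('o, 'm) precat" and D :: "('p, 'n) precat" and F :: "('o, 'm, 'p, 'n) fctr"
begin

lemma isomorphic_map:
  assumes "isomorphic C A B"
  shows "isomorphic D (obj_map F A) (obj_map F B)"
proof -
  obtain f g where f: "f \<in> Hom C A B" "g \<in> Hom C B A" "g \<cdot>\<^bsub>C\<^esub> f = Id C A" "f \<cdot>\<^bsub>C\<^esub> g = Id C B"
    using assms unfolding isomorphic_iff by blast
  have "arr_map F g \<cdot>\<^bsub>D\<^esub> arr_map F f = Id D (obj_map F A)"
    "arr_map F f \<cdot>\<^bsub>D\<^esub> arr_map F g = Id D (obj_map F B)"
    using arr_map_Comp[OF f(1,2)] arr_map_Comp[OF f(2,1)] f(3,4)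
      arr_map_Id[OF C.Hom_Obj(1)[OF f(1)]] arr_map_Id[OF C.Hom_Obj(1)[OF f(2)]] by simp_all
  then show ?thesis
    using isomorphicI[OF arr_map_in[OF f(1)] arr_map_in[OF f(2)]] by blast
qed

end

section \<open>Functors preserving zero, and exact functors\<close>

locale zero_functor = abelian_functor +
  assumes zero_map: "zero_object C A \<Longrightarrow> zero_object D (obj_map F A)"
begin

text \<open>A zero morphism factors through a zero object, so preserving zero objects is
  enough.\<close>

lemma hzero_map:
  assumes "A \<in> Obj C" "B \<in> Obj C"
  shows "arr_map F (hzero C A B) = hzero D (obj_map F A) (obj_map F B)"
proof -
  obtain W where W: "zero_object C W"
    using C.ex_zero_object by blast
  then have "W \<in> Obj C"
    unfolding zero_object_def by blast
  then have h: "hzero C A W \<in> Hom C A W" "hzero C W B \<in> Hom C W B"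
    using assms C.hzero_in by blast+
  have "arr_map F (hzero C A B) = arr_map F (hzero C W B) \<cdot>\<^bsub>D\<^esub> arr_map F (hzero C A W)"
    using arr_map_Comp[OF h] C.Comp_hzero[OF h(2) assms(1)] by simp
  also have "arr_map F (hzero C A W) = hzero D (obj_map F A) (obj_map F W)"
    using D.Hom_to_zero[OF zero_map[OF W] arr_map_in[OF h(1)]] .
  finally show ?thesis
    using D.Comp_hzero[OF arr_map_in[OF h(2)] obj_map_in[OF assms(1)]] by simp
qed

lemma Comp_zero_map:
  assumes "f \<in> Hom C A B" "g \<in> Hom C B E" "g \<cdot>\<^bsub>C\<^esub> f = hzero C A E"
  shows "arr_map F g \<cdot>\<^bsub>D\<^esub> arr_map F f = hzero D (obj_map F A) (obj_map F E)"
  using arr_map_Comp[OF assms(1,2)] assms(3) hzero_map C.Hom_Obj(1)[OF assms(1)]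
    C.Hom_Obj(2)[OF assms(2)] by simp

end

locale exact_abelian_functor = abelian_functor +
  assumes exact: "exact_functor C D F"
begin

lemma short_exact_map:
  "short_exact C L f M g N \<Longrightarrow>
    short_exact D (obj_map F L) (arr_map F f) (obj_map F M) (arr_map F g) (obj_map F N)"
  using exact unfolding exact_functor_def by blast

text \<open>For a zero object \<open>A\<close> the identity taken twice is a short exact sequence.
  Its image is short exact, so the composite of two identities of \<open>obj_map F A\<close> is both
  the identity and zero.\<close>

sublocale zero_functor
proof
  fix A
  assume A: "zero_object C A"
  then have id: "Id C A \<in> Hom C A A" "Id C A = hzero C A A" "A \<in> Obj C"
    using C.Id_in[of A] C.zero_object_iff[of A] by blast+
  have "monic C (Id C A)" "epic C (Id C A)"
    using C.section_monic[OF id(1,1)] C.retraction_epic[OF id(1,1)] C.Comp_Id[OF id(1)] by auto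
  have "short_exact C A (Id C A) A (Id C A) A"
  proof -
    have "is_kernel C (Id C A) (Id C A)"
    proof (rule C.kernelI[OF id(1,1)])
      show "Id C A \<cdot>\<^bsub>C\<^esub> Id C A = hzero C A A"
        using C.Comp_Id[OF id(1)] id(2) by simp
    next
      fix B h
      assume "h \<in> Hom C B A"
      then show "\<exists>u \<in> Hom C B A. Id C A \<cdot>\<^bsub>C\<^esub> u = h"
        using C.Id_Comp by blast
    qed fact
    moreover have "is_cokernel C (Id C A) (Id C A)"
    proof (rule C.cokernelI[OF id(1,1)])
      show "Id C A \<cdot>\<^bsub>C\<^esub> Id C A = hzero C A A"
        using C.Comp_Id[OF id(1)] id(2) by simp
    next
      fix B h
      assume "h \<in> Hom C A B"
      then show "\<exists>u \<in> Hom C A B. u \<cdot>\<^bsub>C\<^esub> Id C A = h"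
        using C.Comp_Id by blast
    qed fact
    ultimately show ?thesis
      using id unfolding short_exact_def by blast
  qed
  note S = D.short_exactD[OF short_exact_map[OF this]]
  have "Id D (obj_map F A) = hzero D (obj_map F A) (obj_map F A)"
    using S(7) arr_map_Id[OF id(3)] D.Comp_Id[OF D.Id_in[OF obj_map_in[OF id(3)]]] by simp
  then show "zero_object D (obj_map F A)"
    using obj_map_in[OF id(3)] unfolding D.zero_object_iff by blast
qed

lemma monic_map:
  assumes "f \<in> Hom C A B" "monic C f"
  shows "monic D (arr_map F f)"
proof -
  obtain g N where "short_exact C A f B g N"
    using C.short_exact_monic assms by blast
  then show ?thesis
    using short_exact_map D.short_exactD(5) by blast
qed

lemma epic_map:
  assumes "f \<in> Hom C A B" "epic C f"
  shows "epic D (arr_map F f)"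
proof -
  obtain g N where "short_exact C N g A f B"
    using C.short_exact_epic assms by blast
  then show ?thesis
    using short_exact_map D.short_exactD(6) by blast
qed

end

lemma fully_faithful_faithful:
  assumes "fully_faithful C D F" "A \<in> Obj C" "B \<in> Obj C" "f \<in> Hom C A B" "g \<in> Hom C A B"
    and "arr_map F f = arr_map F g"
  shows "f = g"
  using assms unfolding fully_faithful_def bij_betw_def inj_on_def by blast

lemma fully_faithful_full:
  assumes "fully_faithful C D F" "A \<in> Obj C" "B \<in> Obj C" "g \<in> Hom D (obj_map F A) (obj_map F B)"
  obtains f where "f \<in> Hom C A B" "arr_map F f = g"
proof -
  have "bij_betw (arr_map F) (Hom C A B) (Hom D (obj_map F A) (obj_map F B))"
    using assms(1-3) unfolding fully_faithful_def by blast
  then have "g \<in> arr_map F ` Hom C A B"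
    using assms(4) unfolding bij_betw_def by simp
  then show thesis
    using that by auto
qed

section \<open>Adjunctions between abelian categories\<close>

locale abelian_adjunction =
  C: abelian_category C + D: abelian_category D + F: cat_functor C D F + G: cat_functor D C G
  for C :: "('o, 'm) precat" and D :: "('p, 'n) precat"
    and F :: "('o, 'm, 'p, 'n) fctr" and G :: "('p, 'n, 'o, 'm) fctr" +
  assumes adjoint: "adjoint_pair C D F G"
begin

text \<open>\<open>adjoint_pair\<close> only asserts that a natural family of bijections exists. One
  family is chosen here, so that units and counits become transposes of identities.\<close>

definition transp :: "'o \<Rightarrow> 'p \<Rightarrow> 'n \<Rightarrow> 'm" where
  "transp = (SOME \<phi>. (\<forall>A \<in> Obj C. \<forall>B \<in> Obj D.
             bij_betw (\<phi> A B) (Hom D (obj_map F A) B) (Hom C A (obj_map G B))) \<and>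
          (\<forall>A \<in> Obj C. \<forall>A' \<in> Obj C. \<forall>B \<in> Obj D. \<forall>B' \<in> Obj D.
             \<forall>a \<in> Hom C A' A. \<forall>b \<in> Hom D B B'. \<forall>h \<in> Hom D (obj_map F A) B.
               \<phi> A' B' (b \<cdot>\<^bsub>D\<^esub> h \<cdot>\<^bsub>D\<^esub> arr_map F a)
                 = arr_map G b \<cdot>\<^bsub>C\<^esub> \<phi> A B h \<cdot>\<^bsub>C\<^esub> a))"

lemma
  shows transp_bij: "\<lbrakk>A \<in> Obj C; B \<in> Obj D\<rbrakk>
      \<Longrightarrow> bij_betw (transp A B) (Hom D (obj_map F A) B) (Hom C A (obj_map G B))"
    and transp_natural: "\<lbrakk>A \<in> Obj C; A' \<in> Obj C; B \<in> Obj D; B' \<in> Obj D;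
        a \<in> Hom C A' A; b \<in> Hom D B B'; h \<in> Hom D (obj_map F A) B\<rbrakk>
      \<Longrightarrow> transp A' B' (b \<cdot>\<^bsub>D\<^esub> h \<cdot>\<^bsub>D\<^esub> arr_map F a)
        = arr_map G b \<cdot>\<^bsub>C\<^esub> transp A B h \<cdot>\<^bsub>C\<^esub> a"
  using someI_ex[OF adjoint[unfolded adjoint_pair_def], folded transp_def] by blast+

lemma transp_in:
  assumes "h \<in> Hom D (obj_map F A) B" "A \<in> Obj C"
  shows "transp A B h \<in> Hom C A (obj_map G B)"
  using transp_bij[OF assms(2) D.Hom_Obj(2)[OF assms(1)]] assms(1) by (auto simp: bij_betw_def)

lemma transp_inj:
  assumes "transp A B h = transp A B h'" "A \<in> Obj C"
    and "h \<in> Hom D (obj_map F A) B" "h' \<in> Hom D (obj_map F A) B"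
  shows "h = h'"
  using transp_bij[OF assms(2) D.Hom_Obj(2)[OF assms(3)]] assms(1,3,4)
  unfolding bij_betw_def inj_on_def by blast

lemma transp_surj:
  assumes "k \<in> Hom C A (obj_map G B)" "B \<in> Obj D"
  obtains h where "h \<in> Hom D (obj_map F A) B" "transp A B h = k"
proof -
  have "k \<in> transp A B ` Hom D (obj_map F A) B"
    using transp_bij[OF C.Hom_Obj(1)[OF assms(1)] assms(2)] assms(1) unfolding bij_betw_def by simp
  then show thesis
    using that by auto
qed

text \<open>Naturality is given in both variables at once; an identity in the first slot isolates
  the second, and \<open>transp_pre\<close> does the converse.\<close>

lemma transp_post:
  assumes h: "h \<in> Hom D (obj_map F A) B" and b: "b \<in> Hom D B B'" and A: "A \<in> Obj C"
  shows "transp A B' (b \<cdot>\<^bsub>D\<^esub> h) = arr_map G b \<cdot>\<^bsub>C\<^esub> transp A B h"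
  using transp_natural[OF A A D.Hom_Obj[OF b] C.Id_in[OF A] b h] F.arr_map_Id[OF A]
    D.Comp_Id[OF D.Comp_in[OF h b]]
    C.Comp_Id[OF C.Comp_in[OF transp_in[OF h A] G.arr_map_in[OF b]]]
  by simp

lemma transp_pre:
  assumes h: "h \<in> Hom D (obj_map F A) B" and a: "a \<in> Hom C A' A"
  shows "transp A' B (h \<cdot>\<^bsub>D\<^esub> arr_map F a) = transp A B h \<cdot>\<^bsub>C\<^esub> a"
proof -
  have B: "B \<in> Obj D"
    using D.Hom_Obj[OF h] by blast
  show ?thesis
    using transp_natural[OF C.Hom_Obj(2,1)[OF a] B B a D.Id_in[OF B] h] G.arr_map_Id[OF B]
      D.Id_Comp[OF h] C.Id_Comp[OF transp_in[OF h C.Hom_Obj(2)[OF a]]]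
    by simp
qed

text \<open>All morphisms out of \<open>A\<close> agree, so the identity and the zero endomorphism
  of \<open>obj_map F A\<close> have equal transposes. Injectivity of \<open>transp\<close>
  identifies them.\<close>

lemma left_zero:
  assumes A: "zero_object C A"
  shows "zero_object D (obj_map F A)"
proof -
  have obj: "A \<in> Obj C"
    using A unfolding zero_object_def by blast
  note FA = F.obj_map_in[OF obj]
  have "transp A (obj_map F A) (Id D (obj_map F A))
      = transp A (obj_map F A) (hzero D (obj_map F A) (obj_map F A))"
    using C.Hom_from_zero[OF A transp_in[OF D.Id_in[OF FA] obj]]
      C.Hom_from_zero[OF A transp_in[OF D.hzero_in[OF FA FA] obj]] by simp
  then show ?thesis
    using transp_inj obj D.Id_in D.hzero_in FA unfolding D.zero_object_iff by blast
qed

lemma right_zero: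
  assumes B: "zero_object D B"
  shows "zero_object C (obj_map G B)"
proof -
  have obj: "B \<in> Obj D"
    using B unfolding zero_object_def by blast
  note GB = G.obj_map_in[OF obj]
  obtain h h' where h: "h \<in> Hom D (obj_map F (obj_map G B)) B"
      "transp (obj_map G B) B h = Id C (obj_map G B)"
    and h': "h' \<in> Hom D (obj_map F (obj_map G B)) B"
      "transp (obj_map G B) B h' = hzero C (obj_map G B) (obj_map G B)"
    using transp_surj[OF C.Id_in[OF GB] obj] transp_surj[OF C.hzero_in[OF GB GB] obj] by metis
  have "h = h'"
    using D.Hom_to_zero[OF B h(1)] D.Hom_to_zero[OF B h'(1)] by simp
  then show ?thesis
    using h h' GB unfolding C.zero_object_iff by simp
qed

sublocale F: zero_functor C D F
  by unfold_locales (rule left_zero)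

sublocale G: zero_functor D C G
  by unfold_locales (rule right_zero)

text \<open>\<open>transp\<close> is given as a bijection of sets, with no additivity built in. Zero
  is still preserved, since naturality writes the transpose as the image under \<open>G\<close> of a
  zero morphism after the unit.\<close>

lemma transp_hzero:
  assumes A: "A \<in> Obj C" and B: "B \<in> Obj D"
  shows "transp A B (hzero D (obj_map F A) B) = hzero C A (obj_map G B)"
proof -
  note FA = F.obj_map_in[OF A]
  note id = D.Id_in[OF FA]
  note z = D.hzero_in[OF FA B]
  have "transp A B (hzero D (obj_map F A) B)
      = arr_map G (hzero D (obj_map F A) B) \<cdot>\<^bsub>C\<^esub> transp A (obj_map F A) (Id D (obj_map F A))"
    using transp_post[OF id z A] D.Comp_Id[OF z] by simp
  then show ?thesis
    using G.hzero_map[OF FA B] C.hzero_Comp[OF transp_in[OF id A] G.obj_map_in[OF B]] by simp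
qed

text \<open>A test morphism into \<open>obj_map G M\<close> transposes to one into \<open>M\<close>.
  As \<open>transp\<close> respects zero and composition, the factorisation through \<open>k\<close>
  can be found in \<open>D\<close> and transposed back.\<close>

lemma right_kernel:
  assumes k: "k \<in> Hom D L M" and f: "f \<in> Hom D M N" and K: "is_kernel D k f"
  shows "is_kernel C (arr_map G k) (arr_map G f)"
proof (rule C.kernelI[OF G.arr_map_in[OF k] G.arr_map_in[OF f]])
  note Obj = D.Hom_Obj[OF k] D.Hom_Obj[OF f]
  show "arr_map G f \<cdot>\<^bsub>C\<^esub> arr_map G k = hzero C (obj_map G L) (obj_map G N)"
    using G.Comp_zero_map[OF k f] K unfolding is_kernel_iff[OF k f] by blast
  show "monic C (arr_map G k)"
  proof (rule C.monicI_zero[OF G.arr_map_in[OF k]])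
    fix A h
    assume h: "h \<in> Hom C A (obj_map G L)"
      "arr_map G k \<cdot>\<^bsub>C\<^esub> h = hzero C A (obj_map G M)"
    note A = C.Hom_Obj(1)[OF h(1)]
    obtain h' where h': "h' \<in> Hom D (obj_map F A) L" "transp A L h' = h"
      using transp_surj[OF h(1) Obj(1)] .
    have "transp A M (k \<cdot>\<^bsub>D\<^esub> h') = transp A M (hzero D (obj_map F A) M)"
      using transp_post[OF h'(1) k A] h'(2) h(2) transp_hzero[OF A Obj(2)] by simp
    then have "k \<cdot>\<^bsub>D\<^esub> h' = hzero D (obj_map F A) M"
      using transp_inj[OF _ A D.Comp_in[OF h'(1) k] D.hzero_in[OF F.obj_map_in[OF A] Obj(2)]] by blast
    then have "h' = hzero D (obj_map F A) L"
      using D.monic_cancel_zero[OF D.kernel_monic[OF K] k h'(1)] by blast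
    then show "h = hzero C A (obj_map G L)"
      using h'(2) transp_hzero[OF A Obj(1)] by simp
  qed
  fix A h
  assume h: "h \<in> Hom C A (obj_map G M)" "arr_map G f \<cdot>\<^bsub>C\<^esub> h = hzero C A (obj_map G N)"
  note A = C.Hom_Obj(1)[OF h(1)]
  obtain h' where h': "h' \<in> Hom D (obj_map F A) M" "transp A M h' = h"
    using transp_surj[OF h(1) Obj(2)] .
  have "transp A N (f \<cdot>\<^bsub>D\<^esub> h') = transp A N (hzero D (obj_map F A) N)"
    using transp_post[OF h'(1) f A] h'(2) h(2) transp_hzero[OF A Obj(4)] by simp
  then have "f \<cdot>\<^bsub>D\<^esub> h' = hzero D (obj_map F A) N"
    using transp_inj[OF _ A D.Comp_in[OF h'(1) f] D.hzero_in[OF F.obj_map_in[OF A] Obj(4)]] by blast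
  then obtain u where u: "u \<in> Hom D (obj_map F A) L" "k \<cdot>\<^bsub>D\<^esub> u = h'"
    using D.kernel_factor[OF K k f h'(1)] by blast
  have "arr_map G k \<cdot>\<^bsub>C\<^esub> transp A L u = h"
    using transp_post[OF u(1) k A] u(2) h'(2) by simp
  then show "\<exists>u \<in> Hom C A (obj_map G L). arr_map G k \<cdot>\<^bsub>C\<^esub> u = h"
    using transp_in[OF u(1) A] by blast
qed

lemma left_cokernel:
  assumes q: "q \<in> Hom C M N" and f: "f \<in> Hom C L M" and K: "is_cokernel C q f"
  shows "is_cokernel D (arr_map F q) (arr_map F f)"
proof (rule D.cokernelI[OF F.arr_map_in[OF q] F.arr_map_in[OF f]])
  note Obj = C.Hom_Obj[OF q] C.Hom_Obj[OF f]
  show "arr_map F q \<cdot>\<^bsub>D\<^esub> arr_map F f = hzero D (obj_map F L) (obj_map F N)"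
    using F.Comp_zero_map[OF f q] K unfolding is_cokernel_iff[OF q f] by blast
  show "epic D (arr_map F q)"
  proof (rule D.epicI_zero[OF F.arr_map_in[OF q]])
    fix B h
    assume h: "h \<in> Hom D (obj_map F N) B"
      "h \<cdot>\<^bsub>D\<^esub> arr_map F q = hzero D (obj_map F M) B"
    note B = D.Hom_Obj(2)[OF h(1)]
    have "transp N B h \<cdot>\<^bsub>C\<^esub> q = hzero C M (obj_map G B)"
      using transp_pre[OF h(1) q] h(2) transp_hzero[OF Obj(1) B] by simp
    then have "transp N B h = transp N B (hzero D (obj_map F N) B)"
      using C.epic_cancel_zero[OF C.cokernel_epic[OF K] q transp_in[OF h(1) Obj(2)]]
        transp_hzero[OF Obj(2) B] by simp
    then show "h = hzero D (obj_map F N) B"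
      using transp_inj[OF _ Obj(2) h(1) D.hzero_in[OF F.obj_map_in[OF Obj(2)] B]] by blast
  qed
  fix B h
  assume h: "h \<in> Hom D (obj_map F M) B" "h \<cdot>\<^bsub>D\<^esub> arr_map F f = hzero D (obj_map F L) B"
  note B = D.Hom_Obj(2)[OF h(1)]
  have "transp M B h \<cdot>\<^bsub>C\<^esub> f = hzero C L (obj_map G B)"
    using transp_pre[OF h(1) f] h(2) transp_hzero[OF Obj(3) B] by simp
  then obtain u where u: "u \<in> Hom C N (obj_map G B)" "u \<cdot>\<^bsub>C\<^esub> q = transp M B h"
    using C.cokernel_factor[OF K q f transp_in[OF h(1) Obj(1)]] by blast
  obtain u' where u': "u' \<in> Hom D (obj_map F N) B" "transp N B u' = u"
    using transp_surj[OF u(1) B] .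
  have "transp M B (u' \<cdot>\<^bsub>D\<^esub> arr_map F q) = transp M B h"
    using transp_pre[OF u'(1) q] u(2) u'(2) by simp
  then have "u' \<cdot>\<^bsub>D\<^esub> arr_map F q = h"
    using transp_inj[OF _ Obj(1) D.Comp_in[OF F.arr_map_in[OF q] u'(1)] h(1)] by blast
  then show "\<exists>u \<in> Hom D (obj_map F N) B. u \<cdot>\<^bsub>D\<^esub> arr_map F q = h"
    using u'(1) by blast
qed

lemma right_monic:
  assumes "f \<in> Hom D A B" "monic D f"
  shows "monic C (arr_map G f)"
  using D.short_exact_monic[OF assms] C.kernel_monic[OF right_kernel] D.short_exactD(1,2,3) by metis

text \<open>A left adjoint preserves cokernels; once \<open>arr_map F f\<close> is monic, it is the
  kernel of its cokernel \<open>arr_map F g\<close>. The criterion is meant for functors that are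
  also right adjoints, which preserve monomorphisms.\<close>

lemma left_monic_right_exact:
  assumes "\<And>A B f. \<lbrakk>f \<in> Hom C A B; monic C f\<rbrakk> \<Longrightarrow> monic D (arr_map F f)"
  shows "exact_functor C D F"
  unfolding exact_functor_def
proof (intro allI impI)
  fix L f M g N
  assume S: "short_exact C L f M g N"
  note S = C.short_exactD[OF S]
  note K = left_cokernel[OF S(2,1,4)]
  have "is_kernel D (arr_map F f) (arr_map F g)"
    using D.monic_is_kernel[OF F.arr_map_in[OF S(1)] assms[OF S(1,5)] F.arr_map_in[OF S(2)] K] .
  then show "short_exact D (obj_map F L) (arr_map F f) (obj_map F M) (arr_map F g) (obj_map F N)"
    using K F.arr_map_in S(1,2) unfolding short_exact_def by blast
qed

lemma right_epic_left_exact: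
  assumes "\<And>A B f. \<lbrakk>f \<in> Hom D A B; epic D f\<rbrakk> \<Longrightarrow> epic C (arr_map G f)"
  shows "exact_functor D C G"
  unfolding exact_functor_def
proof (intro allI impI)
  fix L f M g N
  assume S: "short_exact D L f M g N"
  note S = D.short_exactD[OF S]
  note K = right_kernel[OF S(1,2,3)]
  have "is_cokernel C (arr_map G g) (arr_map G f)"
    using C.epic_is_cokernel[OF G.arr_map_in[OF S(2)] assms[OF S(2,6)] G.arr_map_in[OF S(1)] K] .
  then show "short_exact C (obj_map G L) (arr_map G f) (obj_map G M) (arr_map G g) (obj_map G N)"
    using K G.arr_map_in S(1,2) unfolding short_exact_def by blast
qed

text \<open>
  For fully faithful \<open>G\<close> the inverse of the counit at \<open>B\<close> is the preimage under \<open>G\<close> of the unit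
  at \<open>G B\<close>.
\<close>

lemma counit_iso:
  assumes ff: "fully_faithful D C G" and B: "B \<in> Obj D"
  obtains e u where "e \<in> Hom D (obj_map F (obj_map G B)) B" "u \<in> Hom D B (obj_map F (obj_map G B))"
    "e \<cdot>\<^bsub>D\<^esub> u = Id D B" "u \<cdot>\<^bsub>D\<^esub> e = Id D (obj_map F (obj_map G B))"
    "transp (obj_map G B) B e = Id C (obj_map G B)"
proof -
  let ?GB = "obj_map G B" and ?FGB = "obj_map F (obj_map G B)"
  note GB = G.obj_map_in[OF B]
  note FGB = F.obj_map_in[OF GB]
  note id = D.Id_in[OF FGB]
  obtain e where e: "e \<in> Hom D ?FGB B" "transp ?GB B e = Id C ?GB"
    using transp_surj[OF C.Id_in[OF GB] B] .
  obtain u where u: "u \<in> Hom D B ?FGB" "arr_map G u = transp ?GB ?FGB (Id D ?FGB)"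
    using fully_faithful_full[OF ff B FGB transp_in[OF id GB]] .
  have "transp ?GB ?FGB (u \<cdot>\<^bsub>D\<^esub> e) = transp ?GB ?FGB (Id D ?FGB)"
    using transp_post[OF e(1) u(1) GB] e(2) u(2) C.Comp_Id[OF G.arr_map_in[OF u(1)]] by simp
  then have ue: "u \<cdot>\<^bsub>D\<^esub> e = Id D ?FGB"
    using transp_inj[OF _ GB D.Comp_in[OF e(1) u(1)] id] by blast
  have "arr_map G (e \<cdot>\<^bsub>D\<^esub> u) = arr_map G e \<cdot>\<^bsub>C\<^esub> transp ?GB ?FGB (Id D ?FGB)"
    using G.arr_map_Comp[OF u(1) e(1)] u(2) by simp
  also have "\<dots> = arr_map G (Id D B)"
    using transp_post[OF id e(1) GB] D.Comp_Id[OF e(1)] e(2) G.arr_map_Id[OF B] by simp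
  finally have "e \<cdot>\<^bsub>D\<^esub> u = Id D B"
    using fully_faithful_faithful[OF ff B B D.Comp_in[OF u(1) e(1)] D.Id_in[OF B]] by blast
  then show thesis
    using that e u(1) ue by blast
qed

lemma counit_isomorphic:
  assumes "fully_faithful D C G" "B \<in> Obj D"
  shows "isomorphic D (obj_map F (obj_map G B)) B"
  by (rule counit_iso[OF assms]) (rule isomorphicI)

text \<open>The witness is the unit at \<open>A\<close>. A triangle identity makes \<open>F\<close>
  of it a right inverse of the counit at \<open>obj_map F A\<close>, which is invertible by
  \<open>counit_iso\<close>; hence it equals the inverse \<open>u\<close>.\<close>

lemma ex_unit_iso:
  assumes ff: "fully_faithful D C G" and A: "A \<in> Obj C"
  obtains h where "h \<in> Hom C A (obj_map G (obj_map F A))"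
    "monic D (arr_map F h)" "epic D (arr_map F h)"
proof -
  let ?FA = "obj_map F A" and ?h = "transp A (obj_map F A) (Id D (obj_map F A))"
  note FA = F.obj_map_in[OF A]
  note id = D.Id_in[OF FA]
  note h = transp_in[OF id A]
  obtain e u where e: "e \<in> Hom D (obj_map F (obj_map G ?FA)) ?FA"
    and u: "u \<in> Hom D ?FA (obj_map F (obj_map G ?FA))"
    and ue: "u \<cdot>\<^bsub>D\<^esub> e = Id D (obj_map F (obj_map G ?FA))" "e \<cdot>\<^bsub>D\<^esub> u = Id D ?FA"
    and te: "transp (obj_map G ?FA) ?FA e = Id C (obj_map G ?FA)"
    using counit_iso[OF ff FA] .
  note Fh = F.arr_map_in[OF h]
  have "transp A ?FA (e \<cdot>\<^bsub>D\<^esub> arr_map F ?h) = ?h"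
    using transp_pre[OF e h] te C.Id_Comp[OF h] by simp
  then have eh: "e \<cdot>\<^bsub>D\<^esub> arr_map F ?h = Id D ?FA"
    using transp_inj[OF _ A D.Comp_in[OF Fh e] id] by blast
  have "arr_map F ?h = (u \<cdot>\<^bsub>D\<^esub> e) \<cdot>\<^bsub>D\<^esub> arr_map F ?h"
    using ue D.Id_Comp[OF Fh] by simp
  also have "\<dots> = u"
    using D.Comp_assoc[OF Fh e u] eh D.Comp_Id[OF u] by simp
  finally have "arr_map F ?h = u" .
  then show thesis
    using that[OF h] D.section_monic[OF u e] D.retraction_epic[OF u e] ue by simp
qed

text \<open>Dual to \<open>counit_iso\<close>: the inverse of the unit at \<open>A\<close> is the
  preimage under \<open>F\<close> of the counit \<open>e'\<close> at
  \<open>obj_map F A\<close>.\<close>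

lemma unit_isomorphic:
  assumes ff: "fully_faithful C D F" and A: "A \<in> Obj C"
  shows "isomorphic C (obj_map G (obj_map F A)) A"
proof -
  let ?FA = "obj_map F A" and ?GFA = "obj_map G (obj_map F A)"
  note FA = F.obj_map_in[OF A]
  note GFA = G.obj_map_in[OF FA]
  note id = D.Id_in[OF FA]
  let ?u = "transp A ?FA (Id D ?FA)"
  note u = transp_in[OF id A]
  obtain e' where e': "e' \<in> Hom D (obj_map F ?GFA) ?FA" "transp ?GFA ?FA e' = Id C ?GFA"
    using transp_surj[OF C.Id_in[OF GFA] FA] .
  obtain e where e: "e \<in> Hom C ?GFA A" "arr_map F e = e'"
    using fully_faithful_full[OF ff GFA A e'(1)] .
  have ue: "?u \<cdot>\<^bsub>C\<^esub> e = Id C ?GFA"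
    using transp_pre[OF id e(1)] e(2) e'(2) D.Id_Comp[OF e'(1)] by simp
  have eu: "e \<cdot>\<^bsub>C\<^esub> ?u \<in> Hom C A A"
    using C.Comp_in[OF u e(1)] .
  have "transp A ?FA (e' \<cdot>\<^bsub>D\<^esub> arr_map F ?u) = ?u"
    using transp_pre[OF e'(1) u] e'(2) C.Id_Comp[OF u] by simp
  then have "e' \<cdot>\<^bsub>D\<^esub> arr_map F ?u = Id D ?FA"
    using transp_inj[OF _ A D.Comp_in[OF F.arr_map_in[OF u] e'(1)] id] by blast
  then have "arr_map F (e \<cdot>\<^bsub>C\<^esub> ?u) = arr_map F (Id C A)"
    using F.arr_map_Comp[OF u e(1)] e(2) F.arr_map_Id[OF A] by simp
  then have "e \<cdot>\<^bsub>C\<^esub> ?u = Id C A"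
    using fully_faithful_faithful[OF ff A A eu C.Id_in[OF A]] by blast
  then show ?thesis
    using isomorphicI[OF e(1) u ue] by blast
qed

text \<open>By fullness the transpose of \<open>h\<close> is \<open>arr_map G u\<close> for some
  \<open>u\<close>. If \<open>h\<close> kills the image of \<open>f\<close>, then faithfulness gives
  that \<open>u\<close> kills \<open>f\<close>, so \<open>u\<close> and with it \<open>h\<close>
  vanish.\<close>

lemma epic_left_right_map:
  assumes ff: "fully_faithful D C G" and f: "f \<in> Hom D A B" "epic D f"
  shows "epic D (arr_map F (arr_map G f))"
proof (rule D.epicI_zero[OF F.arr_map_in[OF G.arr_map_in[OF f(1)]]])
  note Obj = D.Hom_Obj[OF f(1)]
  note Gf = G.arr_map_in[OF f(1)]
  fix E h
  assume h: "h \<in> Hom D (obj_map F (obj_map G B)) E"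
    "h \<cdot>\<^bsub>D\<^esub> arr_map F (arr_map G f) = hzero D (obj_map F (obj_map G A)) E"
  note E = D.Hom_Obj(2)[OF h(1)]
  note GB = G.obj_map_in[OF Obj(2)]
  obtain u where u: "u \<in> Hom D B E" "arr_map G u = transp (obj_map G B) E h"
    using fully_faithful_full[OF ff Obj(2) E transp_in[OF h(1) GB]] .
  have "arr_map G (u \<cdot>\<^bsub>D\<^esub> f) = arr_map G (hzero D A E)"
    using G.arr_map_Comp[OF f(1) u(1)] u(2) transp_pre[OF h(1) Gf] h(2)
      transp_hzero[OF G.obj_map_in[OF Obj(1)] E] G.hzero_map[OF Obj(1) E] by simp
  then have "u \<cdot>\<^bsub>D\<^esub> f = hzero D A E"
    using fully_faithful_faithful[OF ff Obj(1) E D.Comp_in[OF f(1) u(1)] D.hzero_in[OF Obj(1) E]]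
    by blast
  then have "u = hzero D B E"
    using D.epic_cancel_zero[OF f(2,1) u(1)] by blast
  then have "transp (obj_map G B) E h
      = transp (obj_map G B) E (hzero D (obj_map F (obj_map G B)) E)"
    using u(2) G.hzero_map[OF Obj(2) E] transp_hzero[OF GB E] by simp
  then show "h = hzero D (obj_map F (obj_map G B)) E"
    using transp_inj[OF _ GB h(1) D.hzero_in[OF F.obj_map_in[OF GB] E]] by blast
qed

end

section \<open>Exact functors with a section\<close>

text \<open>
  For a recollement with \<open>i\<^sup>!\<close> exact, both \<open>(F, G, S) = (i\<^sup>!, j\<^sup>*, i\<^sub>*)\<close> and
  \<open>(F, G, S) = (j\<^sup>*, i\<^sup>!, j\<^sub>*)\<close> are instances.
\<close>

locale exact_section =
  F: exact_abelian_functor X Y F + G: exact_abelian_functor X Z G + S: exact_abelian_functor Y X S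
  for X :: "('ox, 'mx) precat" and Y :: "('oy, 'my) precat" and Z :: "('oz, 'mz) precat"
    and F :: "('ox, 'mx, 'oy, 'my) fctr" and G :: "('ox, 'mx, 'oz, 'mz) fctr"
    and S :: "('oy, 'my, 'ox, 'mx) fctr" +
  assumes section_iso: "A \<in> Obj Y \<Longrightarrow> isomorphic Y (obj_map F (obj_map S A)) A"
    and section_zero: "A \<in> Obj Y \<Longrightarrow> zero_object Z (obj_map G (obj_map S A))"
    and section_faithful: "\<lbrakk>f \<in> Hom Y A B; g \<in> Hom Y A B; arr_map S f = arr_map S g\<rbrakk> \<Longrightarrow> f = g"
    and zero_reflect: "\<lbrakk>M \<in> Obj X; zero_object Y (obj_map F M); zero_object Z (obj_map G M)\<rbrakk>
      \<Longrightarrow> zero_object X M"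
    and section_recover: "\<lbrakk>M \<in> Obj X; zero_object Z (obj_map G M)\<rbrakk>
      \<Longrightarrow> isomorphic X (obj_map S (obj_map F M)) M"
begin

lemma section_zero_reflect:
  assumes "A \<in> Obj Y" "zero_object X (obj_map S A)"
  shows "zero_object Y A"
  using F.D.zero_object_isomorphic[OF section_iso[OF assms(1)] F.zero_map[OF assms(2)]] .

text \<open>A faithful functor that preserves zero morphisms reflects monomorphisms.\<close>

lemma section_monic_reflect:
  assumes f: "f \<in> Hom Y A B" and m: "monic X (arr_map S f)"
  shows "monic Y f"
proof (rule F.D.monicI_zero[OF f])
  fix D g
  assume g: "g \<in> Hom Y D A" "f \<cdot>\<^bsub>Y\<^esub> g = hzero Y D B"
  note Obj = F.D.Hom_Obj[OF g(1)]
  have "arr_map S g = hzero X (obj_map S D) (obj_map S A)"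
    using F.C.monic_cancel_zero[OF m S.arr_map_in[OF f] S.arr_map_in[OF g(1)]
        S.Comp_zero_map[OF g(1) f g(2)]] .
  then show "g = hzero Y D A"
    using section_faithful[OF g(1) F.D.hzero_in[OF Obj]] S.hzero_map[OF Obj] by simp
qed

text \<open>The image \<open>I\<close> of \<open>f\<close> is killed by \<open>G\<close>, being a
  quotient of \<open>M\<close>. It is killed by \<open>F\<close> too, since
  \<open>arr_map F q\<close> is epic and vanishes after cancelling the monic
  \<open>arr_map F m\<close>. So \<open>I\<close> is zero.\<close>

lemma zero_reflect_arr:
  assumes f: "f \<in> Hom X M B" and M: "zero_object Z (obj_map G M)"
    and z: "arr_map F f = hzero Y (obj_map F M) (obj_map F B)"
  shows "f = hzero X M B"
proof -
  obtain I q m where q: "q \<in> Hom X M I" "epic X q" and m: "m \<in> Hom X I B" "monic X m"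
    and mq: "m \<cdot>\<^bsub>X\<^esub> q = f"
    using F.C.image_factorization[OF f] .
  have "arr_map F m \<cdot>\<^bsub>Y\<^esub> arr_map F q = hzero Y (obj_map F M) (obj_map F B)"
    using F.arr_map_Comp[OF q(1) m(1)] mq z by simp
  then have "arr_map F q = hzero Y (obj_map F M) (obj_map F I)"
    using F.D.monic_cancel_zero[OF F.monic_map[OF m] F.arr_map_in[OF m(1)] F.arr_map_in[OF q(1)]]
    by blast
  then have FI: "zero_object Y (obj_map F I)"
    using F.D.zero_object_epic[OF F.epic_map[OF q] F.arr_map_in[OF q(1)]] by blast
  have GI: "zero_object Z (obj_map G I)"
    using G.D.epic_from_zero[OF G.epic_map[OF q] G.arr_map_in[OF q(1)] M] .
  have "zero_object X I"
    using zero_reflect[OF F.C.Hom_Obj(2)[OF q(1)] FI GI] .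
  then show ?thesis
    using F.C.Hom_to_zero[OF _ q(1)] F.C.Comp_hzero[OF m(1) F.C.Hom_Obj(1)[OF q(1)]] mq by simp
qed

text \<open>The kernel \<open>K\<close> of \<open>f\<close> is killed by \<open>G\<close> as a
  subobject of \<open>M\<close>, and by \<open>F\<close> because \<open>arr_map F f\<close> is
  monic.\<close>

lemma monic_reflect:
  assumes f: "f \<in> Hom X M B" and M: "zero_object Z (obj_map G M)" and mono: "monic Y (arr_map F f)"
  shows "monic X f"
proof -
  obtain K k where k: "k \<in> Hom X K M" "is_kernel X k f"
    using F.C.obtain_kernel[OF f] .
  note km = F.C.kernel_monic[OF k(2)]
  have "f \<cdot>\<^bsub>X\<^esub> k = hzero X K B"
    using k(2) unfolding is_kernel_iff[OF k(1) f] by blast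
  then have "arr_map F k = hzero Y (obj_map F K) (obj_map F M)"
    using F.D.monic_cancel_zero[OF mono F.arr_map_in[OF f] F.arr_map_in[OF k(1)]
        F.Comp_zero_map[OF k(1) f]] by blast
  then have FK: "zero_object Y (obj_map F K)"
    using F.D.zero_object_monic[OF F.monic_map[OF k(1) km] F.arr_map_in[OF k(1)]] by blast
  have GK: "zero_object Z (obj_map G K)"
    using G.D.monic_to_zero[OF G.monic_map[OF k(1) km] G.arr_map_in[OF k(1)] M] .
  show ?thesis
    using F.C.monic_kernel_zero[OF f k zero_reflect[OF F.C.Hom_Obj(1)[OF k(1)] FK GK]] .
qed

end

section \<open>Transfer of simple objects and of the left Schur property\<close>

locale exact_section_subcategories = exact_section +
  fixes E_X E_Y E_Z
  assumes subY: "subcategory Y E_Y" and subZ: "subcategory Z E_Z"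
    and E_X: "M \<in> E_X \<longleftrightarrow> M \<in> Obj X \<and> obj_map F M \<in> E_Y \<and> obj_map G M \<in> E_Z"
begin

lemma E_Y_Obj: "A \<in> E_Y \<Longrightarrow> A \<in> Obj Y"
  using subY unfolding subcategory_def by blast

text \<open>The condition on \<open>G\<close> holds automatically, as \<open>E_Z\<close> contains
  all zero objects; the condition on \<open>F\<close> is membership of an object isomorphic to
  \<open>A\<close>.\<close>

lemma section_E_X_iff:
  assumes "A \<in> Obj Y"
  shows "obj_map S A \<in> E_X \<longleftrightarrow> A \<in> E_Y"
  using S.obj_map_in[OF assms] F.D.subcategory_isomorphic[OF subY _ section_iso[OF assms]]
    F.D.subcategory_isomorphic[OF subY _ isomorphic_sym[OF section_iso[OF assms]]]
    G.D.subcategory_zero[OF subZ section_zero[OF assms]]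
  unfolding E_X by blast

lemma extension_closed_glued:
  assumes "extension_closed Y E_Y" "extension_closed Z E_Z"
  shows "extension_closed X E_X"
  unfolding extension_closed_def
proof (intro allI impI)
  fix L f M g N
  assume S: "short_exact X L f M g N" and LN: "L \<in> E_X" "N \<in> E_X"
  have "obj_map F M \<in> E_Y"
    using assms(1) F.short_exact_map[OF S] LN unfolding extension_closed_def E_X by blast
  moreover have "obj_map G M \<in> E_Z"
    using assms(2) G.short_exact_map[OF S] LN unfolding extension_closed_def E_X by blast
  ultimately show "M \<in> E_X"
    using F.C.Hom_Obj(2)[OF F.C.short_exactD(1)[OF S]] unfolding E_X by blast
qed

lemma extension_closed_section:
  assumes "extension_closed X E_X"
  shows "extension_closed Y E_Y"
  unfolding extension_closed_def
proof (intro allI impI)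
  fix L f M g N
  assume S: "short_exact Y L f M g N" and LN: "L \<in> E_Y" "N \<in> E_Y"
  have "obj_map S L \<in> E_X" "obj_map S N \<in> E_X"
    using LN section_E_X_iff E_Y_Obj by blast+
  then have "obj_map S M \<in> E_X"
    using assms S.short_exact_map[OF S] unfolding extension_closed_def by blast
  then show "M \<in> E_Y"
    using section_E_X_iff F.D.Hom_Obj(2)[OF F.D.short_exactD(1)[OF S]] by blast
qed

text \<open>A forbidden sequence around \<open>obj_map F M\<close> is carried by \<open>S\<close> to
  one around \<open>M\<close>, since \<open>G\<close> kills \<open>M\<close> and
  \<open>section_recover\<close> applies. Its ends remain in \<open>E_X\<close> and nonzero.\<close>

lemma simple_in_map:
  assumes M: "simple_in X E_X M" and G: "zero_object Z (obj_map G M)"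
  shows "simple_in Y E_Y (obj_map F M)"
proof -
  have ME: "M \<in> E_X" "M \<in> Obj X" "\<not> zero_object X M"
    using M unfolding simple_in_def E_X by auto
  have False if S: "short_exact Y L f (obj_map F M) g N" and LN: "L \<in> E_Y" "N \<in> E_Y"
    and nz: "\<not> zero_object Y L" "\<not> zero_object Y N" for L f g N
  proof -
    obtain f' g' where "short_exact X (obj_map S L) f' M g' (obj_map S N)"
      using F.C.short_exact_isomorphic[OF S.short_exact_map[OF S] section_recover[OF ME(2) G]] .
    moreover have "obj_map S L \<in> E_X" "obj_map S N \<in> E_X"
      using LN section_E_X_iff E_Y_Obj by blast+
    moreover have "\<not> zero_object X (obj_map S L)" "\<not> zero_object X (obj_map S N)"
      using nz LN section_zero_reflect E_Y_Obj by blast+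
    ultimately show False
      using M unfolding simple_in_def by blast
  qed
  moreover have "\<not> zero_object Y (obj_map F M)"
    using zero_reflect[OF ME(2) _ G] ME(3) by blast
  moreover have "obj_map F M \<in> E_Y"
    using ME(1) unfolding E_X by blast
  ultimately show ?thesis
    unfolding simple_in_def by blast
qed

text \<open>In a forbidden sequence around \<open>obj_map S N\<close> both ends are killed by
  \<open>G\<close>, as a subobject and a quotient of something \<open>G\<close> kills. So
  \<open>F\<close> keeps them nonzero and yields a forbidden sequence around
  \<open>N\<close>.\<close>

lemma simple_in_section:
  assumes N: "simple_in Y E_Y N"
  shows "simple_in X E_X (obj_map S N)"
proof -
  have NE: "N \<in> E_Y" "N \<in> Obj Y" "\<not> zero_object Y N"
    using N E_Y_Obj unfolding simple_in_def by auto
  have False if S: "short_exact X A f (obj_map S N) g B" and AB: "A \<in> E_X" "B \<in> E_X"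
    and nz: "\<not> zero_object X A" "\<not> zero_object X B" for A f g B
  proof -
    note GS = G.D.short_exactD[OF G.short_exact_map[OF S]]
    have "zero_object Z (obj_map G A)" "zero_object Z (obj_map G B)"
      using G.D.monic_to_zero[OF GS(5,1) section_zero[OF NE(2)]]
        G.D.epic_from_zero[OF GS(6,2) section_zero[OF NE(2)]] by auto
    then have "\<not> zero_object Y (obj_map F A)" "\<not> zero_object Y (obj_map F B)"
      using nz AB zero_reflect unfolding E_X by blast+
    moreover obtain f' g' where "short_exact Y (obj_map F A) f' N g' (obj_map F B)"
      using F.D.short_exact_isomorphic[OF F.short_exact_map[OF S] section_iso[OF NE(2)]] .
    moreover have "obj_map F A \<in> E_Y" "obj_map F B \<in> E_Y"
      using AB unfolding E_X by blast+
    ultimately show False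
      using N unfolding simple_in_def by blast
  qed
  moreover have "\<not> zero_object X (obj_map S N)"
    using NE section_zero_reflect by blast
  moreover have "obj_map S N \<in> E_X"
    using NE section_E_X_iff by blast
  ultimately show ?thesis
    unfolding simple_in_def by blast
qed

lemma left_schurian_lift:
  assumes M: "simple_in X E_X M" and G: "zero_object Z (obj_map G M)"
    and Y: "left_schur Y E_Y"
  shows "left_schurian X E_X M"
proof -
  have FM: "left_schurian Y E_Y (obj_map F M)"
    using Y simple_in_map[OF M G] unfolding left_schur_def by blast
  have "f = hzero X M B \<or> monic X f" if B: "B \<in> E_X" and f: "f \<in> Hom X M B" for B f
    using FM F.arr_map_in[OF f] B zero_reflect_arr[OF f G] monic_reflect[OF f G]
    unfolding left_schurian_def E_X by blast
  moreover have "M \<in> Obj X" "\<not> zero_object X M"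
    using M unfolding simple_in_def E_X by auto
  ultimately show ?thesis
    unfolding left_schurian_def by blast
qed

text \<open>\<open>S\<close> takes simple objects of \<open>E_Y\<close> to simple objects of
  \<open>E_X\<close>, and by faithfulness it reflects zero morphisms and monomorphisms.\<close>

lemma left_schur_section:
  assumes X: "left_schur X E_X"
  shows "left_schur Y E_Y"
  unfolding left_schur_def
proof (intro conjI allI impI)
  show "extension_closed Y E_Y"
    using X extension_closed_section unfolding left_schur_def by blast
next
  fix N
  assume N: "simple_in Y E_Y N"
  then have NE: "N \<in> Obj Y" "\<not> zero_object Y N"
    using E_Y_Obj unfolding simple_in_def by auto
  have SN: "left_schurian X E_X (obj_map S N)"
    using X simple_in_section[OF N] unfolding left_schur_def by blast
  have "f = hzero Y N B \<or> monic Y f" if B: "B \<in> E_Y" and f: "f \<in> Hom Y N B" for B f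
  proof -
    note Obj = F.D.Hom_Obj[OF f]
    have "arr_map S f = hzero X (obj_map S N) (obj_map S B) \<or> monic X (arr_map S f)"
      using SN S.arr_map_in[OF f] B section_E_X_iff[OF Obj(2)] unfolding left_schurian_def by blast
    then show ?thesis
      using section_monic_reflect[OF f] section_faithful[OF f F.D.hzero_in[OF Obj]]
        S.hzero_map[OF Obj] by auto
  qed
  then show "left_schurian Y E_Y N"
    using NE unfolding left_schurian_def by blast
qed

end

section \<open>Recollements with \<open>i\<^sup>!\<close> exact\<close>

locale exact_recollement = recollement +
  assumes i_shriek_exact: "exact_functor X Y i_shriek"
begin

sublocale adj_i: abelian_adjunction X Y i_star i_lstar
  by unfold_locales (rule adj_i_star_i_lstar)

sublocale adj_i': abelian_adjunction Y X i_lstar i_shriek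
  by unfold_locales (rule adj_i_lstar_i_shriek)

sublocale adj_j: abelian_adjunction Z X j_lshriek j_star
  by unfold_locales (rule adj_j_lshriek_j_star)

sublocale adj_j': abelian_adjunction X Z j_star j_lstar
  by unfold_locales (rule adj_j_star_j_lstar)

sublocale ex_i_shriek: exact_abelian_functor X Y i_shriek
  by unfold_locales (rule i_shriek_exact)

text \<open>\<open>j_star\<close> has adjoints on both sides: as a right adjoint it preserves
  monomorphisms, as a left adjoint cokernels. The same holds for \<open>i_lstar\<close>
  below.\<close>

sublocale ex_j_star: exact_abelian_functor X Z j_star
  by unfold_locales (rule adj_j'.left_monic_right_exact[OF adj_j.right_monic])

sublocale ex_i_lstar: exact_abelian_functor Y X i_lstar
  by unfold_locales (rule adj_i'.left_monic_right_exact[OF adj_i.right_monic])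

lemma j_star_i_lstar_zero:
  assumes "A \<in> Obj Y"
  shows "zero_object Z (obj_map j_star (obj_map i_lstar A))"
proof -
  have "obj_map i_lstar A \<in> essential_image Y X i_lstar"
    using assms X.isomorphic_refl i_lstar.obj_map_in unfolding essential_image_def by blast
  then show ?thesis
    unfolding image_eq_kernel functor_kernel_def by blast
qed

text \<open>The identity of \<open>?B\<close> transposes to a morphism from
  \<open>obj_map i_lstar ?B\<close> to \<open>?jA\<close>. Such morphisms correspond to morphisms
  out of \<open>obj_map j_star (obj_map i_lstar ?B)\<close>, which is zero.\<close>

lemma i_shriek_j_lstar_zero:
  assumes A: "A \<in> Obj Z"
  shows "zero_object Y (obj_map i_shriek (obj_map j_lstar A))"
proof -
  let ?jA = "obj_map j_lstar A" and ?B = "obj_map i_shriek (obj_map j_lstar A)"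
  note jA = j_lstar.obj_map_in[OF A]
  note B = i_shriek.obj_map_in[OF jA]
  note iB = i_lstar.obj_map_in[OF B]
  have zero: "h = hzero X (obj_map i_lstar ?B) ?jA" if h: "h \<in> Hom X (obj_map i_lstar ?B) ?jA" for h
  proof -
    have eq: "k = hzero Z (obj_map j_star (obj_map i_lstar ?B)) A"
      if "k \<in> Hom Z (obj_map j_star (obj_map i_lstar ?B)) A" for k
      using Z.Hom_from_zero[OF j_star_i_lstar_zero[OF B] that] .
    obtain k where "k \<in> Hom Z (obj_map j_star (obj_map i_lstar ?B)) A"
      "adj_j'.transp (obj_map i_lstar ?B) A k = h"
      using adj_j'.transp_surj[OF h A] .
    then show ?thesis
      using eq adj_j'.transp_hzero[OF iB A] by simp
  qed
  obtain h where "h \<in> Hom X (obj_map i_lstar ?B) ?jA" "adj_i'.transp ?B ?jA h = Id Y ?B"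
    using adj_i'.transp_surj[OF Y.Id_in[OF B] jA] .
  then have "Id Y ?B = hzero Y ?B ?B"
    using zero adj_i'.transp_hzero[OF B jA] by simp
  then show ?thesis
    using B unfolding Y.zero_object_iff by blast
qed

text \<open>The essential image condition gives \<open>A\<close> as \<open>i_lstar\<close> of some
  \<open>B\<close> up to isomorphism. Applying \<open>i_shriek\<close> shows that \<open>B\<close>
  is isomorphic to \<open>obj_map i_shriek A\<close>.\<close>

lemma i_lstar_recover:
  assumes "A \<in> Obj X" "zero_object Z (obj_map j_star A)"
  shows "isomorphic X (obj_map i_lstar (obj_map i_shriek A)) A"
proof -
  have "A \<in> essential_image Y X i_lstar"
    using assms unfolding image_eq_kernel functor_kernel_def by blast
  then obtain B where B: "B \<in> Obj Y" "isomorphic X (obj_map i_lstar B) A"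
    unfolding essential_image_def by blast
  have "isomorphic Y (obj_map i_shriek A) B"
    using Y.isomorphic_trans[OF isomorphic_sym[OF adj_i'.G.isomorphic_map[OF B(2)]]
        adj_i'.unit_isomorphic[OF ff_i_lstar B(1)]] .
  then show ?thesis
    using X.isomorphic_trans[OF adj_i.G.isomorphic_map B(2)] by blast
qed

lemma zero_reflect:
  assumes "A \<in> Obj X" "zero_object Y (obj_map i_shriek A)" "zero_object Z (obj_map j_star A)"
  shows "zero_object X A"
  using X.zero_object_isomorphic[OF i_lstar_recover[OF assms(1,3)] adj_i.G.zero_map[OF assms(2)]] .

text \<open>The cokernel \<open>Q\<close> of \<open>f\<close> is killed by \<open>j_star\<close>
  because \<open>arr_map j_star f\<close> is epic, and by the exact \<open>i_shriek\<close> because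
  \<open>Q\<close> is a quotient of an object in the image of \<open>j_lstar\<close>.\<close>

lemma epic_to_j_lstar:
  assumes f: "f \<in> Hom X M (obj_map j_lstar N)" and N: "N \<in> Obj Z" and e: "epic Z (arr_map j_star f)"
  shows "epic X f"
proof -
  obtain Q q where q: "q \<in> Hom X (obj_map j_lstar N) Q" "is_cokernel X q f"
    using X.obtain_cokernel[OF f] .
  note qe = X.cokernel_epic[OF q(2)]
  have "q \<cdot>\<^bsub>X\<^esub> f = hzero X M Q"
    using q(2) unfolding is_cokernel_iff[OF q(1) f] by blast
  then have "arr_map j_star q
      = hzero Z (obj_map j_star (obj_map j_lstar N)) (obj_map j_star Q)"
    using Z.epic_cancel_zero[OF e j_star.arr_map_in[OF f] j_star.arr_map_in[OF q(1)]
        adj_j.G.Comp_zero_map[OF f q(1)]] by blast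
  then have jQ: "zero_object Z (obj_map j_star Q)"
    using Z.zero_object_epic[OF ex_j_star.epic_map[OF q(1) qe] j_star.arr_map_in[OF q(1)]] by blast
  have iQ: "zero_object Y (obj_map i_shriek Q)"
    using Y.epic_from_zero[OF ex_i_shriek.epic_map[OF q(1) qe] i_shriek.arr_map_in[OF q(1)]
        i_shriek_j_lstar_zero[OF N]] .
  show ?thesis
    using X.epic_cokernel_zero[OF f q zero_reflect[OF X.Hom_Obj(2)[OF q(1)] iQ jQ]] .
qed

lemma epic_j_lstar:
  assumes "f \<in> Hom Z A B" "epic Z f"
  shows "epic X (arr_map j_lstar f)"
  using epic_to_j_lstar[OF j_lstar.arr_map_in[OF assms(1)] Z.Hom_Obj(2)[OF assms(1)]
      adj_j'.epic_left_right_map[OF ff_j_lstar assms]] .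

sublocale ex_j_lstar: exact_abelian_functor Z X j_lstar
  by unfold_locales (rule adj_j'.right_epic_left_exact[OF epic_j_lstar])

text \<open>The unit \<open>h\<close> is epic by \<open>epic_to_j_lstar\<close>. Its kernel
  \<open>A\<close> is killed by \<open>j_star\<close>: the image of \<open>k\<close> is a
  monomorphism that the monic image of \<open>h\<close> sends to zero.\<close>

lemma torsion_sequence:
  assumes M: "M \<in> Obj X"
  obtains A k q where "short_exact X A k M q (obj_map j_lstar (obj_map j_star M))"
    "zero_object Z (obj_map j_star A)"
proof -
  let ?jM = "obj_map j_star M"
  note jM = j_star.obj_map_in[OF M]
  obtain h where h: "h \<in> Hom X M (obj_map j_lstar ?jM)"
    and mono: "monic Z (arr_map j_star h)" and epi: "epic Z (arr_map j_star h)"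
    using adj_j'.ex_unit_iso[OF ff_j_lstar M] .
  obtain A k where S: "short_exact X A k M h (obj_map j_lstar ?jM)"
    using X.short_exact_epic[OF h epic_to_j_lstar[OF h jM epi]] .
  note jS = Z.short_exactD[OF ex_j_star.short_exact_map[OF S]]
  have "zero_object Z (obj_map j_star A)"
    using Z.zero_object_monic[OF jS(5,1) Z.monic_cancel_zero[OF mono jS(2,1,7)]] .
  then show thesis
    using that S by blast
qed

text \<open>The left end of \<open>torsion_sequence\<close> is killed by \<open>j_star\<close>, and
  by \<open>i_shriek\<close> as a subobject of \<open>M\<close>; so it is zero and the unit is
  invertible.\<close>

lemma j_lstar_recover:
  assumes M: "M \<in> Obj X" "zero_object Y (obj_map i_shriek M)"
  shows "isomorphic X (obj_map j_lstar (obj_map j_star M)) M"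
proof -
  obtain A k q where S: "short_exact X A k M q (obj_map j_lstar (obj_map j_star M))"
    and jA: "zero_object Z (obj_map j_star A)"
    using torsion_sequence[OF M(1)] .
  note iS = Y.short_exactD[OF ex_i_shriek.short_exact_map[OF S]]
  have "zero_object X A"
    using zero_reflect[OF X.Hom_Obj(1)[OF X.short_exactD(1)[OF S]]
        Y.monic_to_zero[OF iS(5,1) M(2)] jA] .
  then show ?thesis
    using isomorphic_sym[OF X.short_exact_zero_left[OF S]] by blast
qed

sublocale sec_i: exact_section X Y Z i_shriek j_star i_lstar
proof unfold_locales
  show "isomorphic Y (obj_map i_shriek (obj_map i_lstar A)) A" if "A \<in> Obj Y" for A
    using adj_i'.unit_isomorphic[OF ff_i_lstar that] .
  show "f = g" if "f \<in> Hom Y A B" "g \<in> Hom Y A B" "arr_map i_lstar f = arr_map i_lstar g" for f g A B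
    using fully_faithful_faithful[OF ff_i_lstar Y.Hom_Obj[OF that(1)] that] .
qed (fact j_star_i_lstar_zero zero_reflect i_lstar_recover)+

sublocale sec_j: exact_section X Z Y j_star i_shriek j_lstar
proof unfold_locales
  show "isomorphic Z (obj_map j_star (obj_map j_lstar A)) A" if "A \<in> Obj Z" for A
    using adj_j'.counit_isomorphic[OF ff_j_lstar that] .
  show "f = g" if "f \<in> Hom Z A B" "g \<in> Hom Z A B" "arr_map j_lstar f = arr_map j_lstar g" for f g A B
    using fully_faithful_faithful[OF ff_j_lstar Z.Hom_Obj[OF that(1)] that] .
qed (blast intro: i_shriek_j_lstar_zero zero_reflect j_lstar_recover)+

lemma left_schur_iff:
  assumes subY: "subcategory Y E_Y" and subZ: "subcategory Z E_Z"
    and E_X: "E_X = {A \<in> Obj X. obj_map j_star A \<in> E_Z \<and> obj_map i_shriek A \<in> E_Y}"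
  shows "left_schur Y E_Y \<and> left_schur Z E_Z \<longleftrightarrow> left_schur X E_X"
proof -
  interpret I: exact_section_subcategories X Y Z i_shriek j_star i_lstar E_X E_Y E_Z
    by unfold_locales (use assms in auto)
  \<comment> \<open>The same situation with \<open>Y\<close> and \<open>Z\<close> exchanged,
    possible because the two conditions defining \<open>E_X\<close> are symmetric.\<close>
  interpret J: exact_section_subcategories X Z Y j_star i_shriek j_lstar E_X E_Z E_Y
    by unfold_locales (use assms in auto)
  have "left_schur X E_X" if YZ: "left_schur Y E_Y" "left_schur Z E_Z"
    unfolding left_schur_def
  proof (intro conjI allI impI)
    show "extension_closed X E_X"
      using I.extension_closed_glued YZ unfolding left_schur_def by blast
  next
    fix M
    assume simple: "simple_in X E_X M"
    then have M: "M \<in> Obj X" "obj_map j_star M \<in> E_Z" "obj_map i_shriek M \<in> E_Y"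
      unfolding simple_in_def E_X by auto
    note jM = j_star.obj_map_in[OF M(1)]
    let ?B = "obj_map j_lstar (obj_map j_star M)"
    obtain A k q where S: "short_exact X A k M q ?B" and jA: "zero_object Z (obj_map j_star A)"
      using torsion_sequence[OF M(1)] .
    note A = X.Hom_Obj(1)[OF X.short_exactD(1)[OF S]]
    \<comment> \<open>\<open>i_shriek\<close> kills the right end \<open>?B\<close>, so
      \<open>A\<close> inherits membership in \<open>E_X\<close> from \<open>M\<close>.\<close>
    have iA: "isomorphic Y (obj_map i_shriek A) (obj_map i_shriek M)"
      using Y.short_exact_zero_right[OF ex_i_shriek.short_exact_map[OF S]
          i_shriek_j_lstar_zero[OF jM]] .
    have "A \<in> E_X"
      using A Y.subcategory_isomorphic[OF subY M(3) isomorphic_sym[OF iA]]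
        Z.subcategory_zero[OF subZ jA] unfolding I.E_X by blast
    moreover have "?B \<in> E_X"
      using J.section_E_X_iff[OF jM] M(2) by blast
    \<comment> \<open>Both ends lie in \<open>E_X\<close>, so simplicity of \<open>M\<close> makes
      one of them vanish. Then \<open>i_shriek\<close> or \<open>j_star\<close> kills
      \<open>M\<close>, and the other of the two functors lifts the Schurian property.\<close>
    ultimately consider "zero_object X A" | "zero_object X ?B"
      using simple S unfolding simple_in_def by blast
    then show "left_schurian X E_X M"
    proof cases
      case 1
      then have "zero_object Y (obj_map i_shriek M)"
        using Y.zero_object_isomorphic[OF iA adj_i'.G.zero_map] by blast
      then show ?thesis
        using J.left_schurian_lift[OF simple _ YZ(2)] by blast
    next
      case 2
      then have "zero_object Z (obj_map j_star M)"
        using sec_j.section_zero_reflect[OF jM] by blast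
      then show ?thesis
        using I.left_schurian_lift[OF simple _ YZ(1)] by blast
    qed
  qed
  \<comment> \<open>For the converse, \<open>i_lstar\<close> and \<open>j_lstar\<close> serve as the
    sections that pull the left Schur property back to \<open>Y\<close> and
    \<open>Z\<close>.\<close>
  then show ?thesis
    using I.left_schur_section J.left_schur_section by blast
qed

end

theorem theorem1p1:
  fixes X :: "('ox, 'mx) precat" and Y :: "('oy, 'my) precat" and Z :: "('oz, 'mz) precat"
    and i_star :: "('ox, 'mx, 'oy, 'my) fctr"
    and i_lstar :: "('oy, 'my, 'ox, 'mx) fctr"
    and i_shriek :: "('ox, 'mx, 'oy, 'my) fctr"
    and j_lshriek :: "('oz, 'mz, 'ox, 'mx) fctr"
    and j_star :: "('ox, 'mx, 'oz, 'mz) fctr"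
    and j_lstar :: "('oz, 'mz, 'ox, 'mx) fctr"
    and E_X :: "'ox set" and E_Y :: "'oy set" and E_Z :: "'oz set"
  assumes "length_abelian_category X" and "length_abelian_category Y" and "length_abelian_category Z"
    and "recollement Y X Z i_star i_lstar i_shriek j_lshriek j_star j_lstar"
    and "subcategory Y E_Y" and "subcategory Z E_Z"
    and "E_X = {A \<in> Obj X. obj_map j_star A \<in> E_Z \<and> obj_map i_shriek A \<in> E_Y}"
    and "exact_functor X Y i_shriek"
  shows "left_schur Y E_Y \<and> left_schur Z E_Z \<longleftrightarrow> left_schur X E_X"
proof -
  interpret exact_recollement Y X Z i_star i_lstar i_shriek j_lshriek j_star j_lstar
    using assms(4,8) by (simp add: exact_recollement_def exact_recollement_axioms_def)
  show ?thesis
    using left_schur_iff assms(5,6,7) .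
qed

end
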